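(* There is a $*$-equivalence of categories $\mathsf{RP}\cong\mathsf{RG}$ between the rectangular planar rook category and the rectangular GICAR category.
   Context: Rectangular planar rook category $\mathsf{RP}$: objects $[n]$, $n\ge0$; $\mathsf{RP}(m,n)$ is the complex vector space spanned by isotopy classes of rectangular diagrams with $m$ marked points on the bottom and $n$ on the top, each marked point being on exactly one string, each string meeting one or two marked points, strings not intersecting, and no string joining two bottom points or two top points. Diagrams correspond to order-preserving partial injections $\{1,\dots,m\}\rightharpoonup\{1,\dots,n\}$ (given by the strings joining bottom to top). Composition is stacking, with floating strings removed; the adjoint is the conjugate-linear extension of vertical reflection. Annular GICAR category $\mathsf{AG}$: the $\mathbb{C}$-linear involutive category with objects $[n]$, $n\ge0$, whose morphisms are $\mathbb{C}$-linear combinations of words $*$-generated by $\alpha_i:[n]\to[n+1]$ $(1\le i\le n+1,\ n\ge0)$, $\alpha_i^*:[n]\to[n-1]$ $(1\le i\le n,\ n\ge1)$, $\tau:[n]\to[n]$ $(n\ge0)$, subject to: (AG1) $\alpha_i\alpha_{j-1}=\alpha_j\alpha_i$ and $\alpha_i^*\alpha_j^*=\alpha_{j-1}^*\alpha_i^*$ for $i<j$; (AG2) $\alpha_i^*\alpha_j=\alpha_{j-1}\alpha_i^*$ if $i<j$, $\alpha_i^*\alpha_i=\mathrm{id}_{[n]}$, $\alpha_i^*\alpha_j=\alpha_j\alpha_{i-1}^*$ if $i>j$; (AG3) $\tau^*=\tau^{-1}$ and $\tau^n=\mathrm{id}_{[n]}$ on $[n]$ (and $\tau=\mathrm{id}$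 on $[0]$); (AG4) $\alpha_i\tau=\tau\alpha_{i-1}$ as morphisms $[n-1]\to[n]$ and $\alpha_i^*\tau=\tau\alpha_{i-1}^*$ as morphisms $[n]\to[n-1]$, for $i=2,\dots,n$. Composition is concatenation; the adjoint reverses words and takes adjoints of letters. Every word in $\mathsf{AG}(m,n)$ has a unique standard form $\alpha_{i_k}\cdots\alpha_{i_1}\tau^r\alpha_{j_1}^*\cdots\alpha_{j_\ell}^*$ with $i_1<\cdots<i_k$, $j_1<\cdots<j_\ell$, $0\le r<m-\ell$ ($r=0$ if $m=\ell$). The rectangular GICAR category $\mathsf{RG}$ is the subcategory of $\mathsf{AG}$ with the same objects whose morphisms are the linear combinations of words whose standard form contains no $\tau$ ($r=0$). *)

theory Defs
  imports Complex_Main "HOL-Library.Poly_Mapping" "HOL-Library.Disjoint_Sets"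
begin

section \<open>Complex-linear involutive categories\<close>

text \<open>
  All spaces of morphisms are subspaces of one ambient type \<open>'m\<close> and may overlap (they all contain
  \<open>0\<close>), so composition and adjoint take the objects as arguments: \<open>ccomp C a b c g f\<close> is
  \<open>g \<circ> f\<close> for \<open>f : a \<rightarrow> b\<close> and \<open>g : b \<rightarrow> c\<close>, and \<open>cadj C a b f : b \<rightarrow> a\<close>.
\<close>

record ('o, 'm) star_cat =
  Obj :: "'o set"
  Hom :: "'o \<Rightarrow> 'o \<Rightarrow> 'm set"
  cid :: "'o \<Rightarrow> 'm"
  ccomp :: "'o \<Rightarrow> 'o \<Rightarrow> 'o \<Rightarrow> 'm \<Rightarrow> 'm \<Rightarrow> 'm"
  cscale :: "complex \<Rightarrow> 'm \<Rightarrow> 'm"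
  cadj :: "'o \<Rightarrow> 'o \<Rightarrow> 'm \<Rightarrow> 'm"

locale linear_star_category =
  fixes C :: "('o, 'm::ab_group_add) star_cat"
  assumes scale: "vector_space (cscale C)"
    and hom_subspace:
      "\<lbrakk>a \<in> Obj C; b \<in> Obj C\<rbrakk> \<Longrightarrow> module.subspace (cscale C) (Hom C a b)"
    and id_hom: "a \<in> Obj C \<Longrightarrow> cid C a \<in> Hom C a a"
    and comp_hom:
      "\<lbrakk>a \<in> Obj C; b \<in> Obj C; c \<in> Obj C; f \<in> Hom C a b; g \<in> Hom C b c\<rbrakk>
        \<Longrightarrow> ccomp C a b c g f \<in> Hom C a c"
    and comp_id_right:
      "\<lbrakk>a \<in> Obj C; b \<in> Obj C; f \<in> Hom C a b\<rbrakk> \<Longrightarrow> ccomp C a a b f (cid C a) = f"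
    and comp_id_left:
      "\<lbrakk>a \<in> Obj C; b \<in> Obj C; f \<in> Hom C a b\<rbrakk> \<Longrightarrow> ccomp C a b b (cid C b) f = f"
    and comp_assoc:
      "\<lbrakk>a \<in> Obj C; b \<in> Obj C; c \<in> Obj C; d \<in> Obj C;
        f \<in> Hom C a b; g \<in> Hom C b c; h \<in> Hom C c d\<rbrakk>
        \<Longrightarrow> ccomp C a c d h (ccomp C a b c g f) = ccomp C a b d (ccomp C b c d h g) f"
    and comp_add_right:
      "\<lbrakk>a \<in> Obj C; b \<in> Obj C; c \<in> Obj C; f \<in> Hom C a b; f' \<in> Hom C a b; g \<in> Hom C b c\<rbrakk>
        \<Longrightarrow> ccomp C a b c g (f + f') = ccomp C a b c g f + ccomp C a b c g f'"
    and comp_add_left: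
      "\<lbrakk>a \<in> Obj C; b \<in> Obj C; c \<in> Obj C; f \<in> Hom C a b; g \<in> Hom C b c; g' \<in> Hom C b c\<rbrakk>
        \<Longrightarrow> ccomp C a b c (g + g') f = ccomp C a b c g f + ccomp C a b c g' f"
    and comp_scale_right:
      "\<lbrakk>a \<in> Obj C; b \<in> Obj C; c \<in> Obj C; f \<in> Hom C a b; g \<in> Hom C b c\<rbrakk>
        \<Longrightarrow> ccomp C a b c g (cscale C z f) = cscale C z (ccomp C a b c g f)"
    and comp_scale_left:
      "\<lbrakk>a \<in> Obj C; b \<in> Obj C; c \<in> Obj C; f \<in> Hom C a b; g \<in> Hom C b c\<rbrakk>
        \<Longrightarrow> ccomp C a b c (cscale C z g) f = cscale C z (ccomp C a b c g f)"
    and adj_hom: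
      "\<lbrakk>a \<in> Obj C; b \<in> Obj C; f \<in> Hom C a b\<rbrakk> \<Longrightarrow> cadj C a b f \<in> Hom C b a"
    and adj_adj:
      "\<lbrakk>a \<in> Obj C; b \<in> Obj C; f \<in> Hom C a b\<rbrakk> \<Longrightarrow> cadj C b a (cadj C a b f) = f"
    and adj_comp:
      "\<lbrakk>a \<in> Obj C; b \<in> Obj C; c \<in> Obj C; f \<in> Hom C a b; g \<in> Hom C b c\<rbrakk>
        \<Longrightarrow> cadj C a c (ccomp C a b c g f) = ccomp C c b a (cadj C a b f) (cadj C b c g)"
    and adj_add:
      "\<lbrakk>a \<in> Obj C; b \<in> Obj C; f \<in> Hom C a b; f' \<in> Hom C a b\<rbrakk>
        \<Longrightarrow> cadj C a b (f + f') = cadj C a b f + cadj C a b f'"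
    and adj_scale:
      "\<lbrakk>a \<in> Obj C; b \<in> Obj C; f \<in> Hom C a b\<rbrakk>
        \<Longrightarrow> cadj C a b (cscale C z f) = cscale C (cnj z) (cadj C a b f)"

text \<open>A functor is given by its object map \<open>Fo\<close> and its morphism maps
  \<open>Fm a b : Hom C a b \<rightarrow> Hom D (Fo a) (Fo b)\<close>.\<close>

locale star_functor =
  fixes C :: "('o, 'm::ab_group_add) star_cat" and D :: "('p, 'n::ab_group_add) star_cat"
    and Fo :: "'o \<Rightarrow> 'p" and Fm :: "'o \<Rightarrow> 'o \<Rightarrow> 'm \<Rightarrow> 'n"
  assumes obj: "a \<in> Obj C \<Longrightarrow> Fo a \<in> Obj D"
    and hom: "\<lbrakk>a \<in> Obj C; b \<in> Obj C; f \<in> Hom C a b\<rbrakk> \<Longrightarrow> Fm a b f \<in> Hom D (Fo a) (Fo b)"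
    and id: "a \<in> Obj C \<Longrightarrow> Fm a a (cid C a) = cid D (Fo a)"
    and comp:
      "\<lbrakk>a \<in> Obj C; b \<in> Obj C; c \<in> Obj C; f \<in> Hom C a b; g \<in> Hom C b c\<rbrakk>
        \<Longrightarrow> Fm a c (ccomp C a b c g f) = ccomp D (Fo a) (Fo b) (Fo c) (Fm b c g) (Fm a b f)"
    and add:
      "\<lbrakk>a \<in> Obj C; b \<in> Obj C; f \<in> Hom C a b; f' \<in> Hom C a b\<rbrakk>
        \<Longrightarrow> Fm a b (f + f') = Fm a b f + Fm a b f'"
    and scale:
      "\<lbrakk>a \<in> Obj C; b \<in> Obj C; f \<in> Hom C a b\<rbrakk>
        \<Longrightarrow> Fm a b (cscale C z f) = cscale D z (Fm a b f)"
    and adj: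
      "\<lbrakk>a \<in> Obj C; b \<in> Obj C; f \<in> Hom C a b\<rbrakk>
        \<Longrightarrow> Fm b a (cadj C a b f) = cadj D (Fo a) (Fo b) (Fm a b f)"

definition unitary_nat_iso ::
  "('o, 'm::ab_group_add) star_cat \<Rightarrow> ('p, 'n::ab_group_add) star_cat
    \<Rightarrow> ('o \<Rightarrow> 'p) \<Rightarrow> ('o \<Rightarrow> 'o \<Rightarrow> 'm \<Rightarrow> 'n) \<Rightarrow> ('o \<Rightarrow> 'p) \<Rightarrow> ('o \<Rightarrow> 'o \<Rightarrow> 'm \<Rightarrow> 'n)
    \<Rightarrow> ('o \<Rightarrow> 'n) \<Rightarrow> bool"
  where "unitary_nat_iso C D Fo Fm Go Gm \<eta> \<longleftrightarrow>
    (\<forall>a\<in>Obj C. \<eta> a \<in> Hom D (Fo a) (Go a) \<and>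
      ccomp D (Fo a) (Go a) (Fo a) (cadj D (Fo a) (Go a) (\<eta> a)) (\<eta> a) = cid D (Fo a) \<and>
      ccomp D (Go a) (Fo a) (Go a) (\<eta> a) (cadj D (Fo a) (Go a) (\<eta> a)) = cid D (Go a)) \<and>
    (\<forall>a\<in>Obj C. \<forall>b\<in>Obj C. \<forall>f\<in>Hom C a b.
      ccomp D (Fo a) (Fo b) (Go b) (\<eta> b) (Fm a b f) =
      ccomp D (Fo a) (Go a) (Go b) (Gm a b f) (\<eta> a))"

definition star_equivalent ::
  "('o, 'm::ab_group_add) star_cat \<Rightarrow> ('p, 'n::ab_group_add) star_cat \<Rightarrow> bool"
  where "star_equivalent C D \<longleftrightarrow>
    linear_star_category C \<and> linear_star_category D \<and>
    (\<exists>Fo Fm Go Gm \<eta> \<epsilon>.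
      star_functor C D Fo Fm \<and> star_functor D C Go Gm \<and>
      unitary_nat_iso C C (\<lambda>a. a) (\<lambda>a b f. f)
        (\<lambda>a. Go (Fo a)) (\<lambda>a b f. Gm (Fo a) (Fo b) (Fm a b f)) \<eta> \<and>
      unitary_nat_iso D D (\<lambda>a. Fo (Go a)) (\<lambda>a b f. Fm (Go a) (Go b) (Gm a b f))
        (\<lambda>a. a) (\<lambda>a b f. f) \<epsilon>)"

section \<open>Linear combinations of basis morphisms\<close>

definition lin_on :: "'b set \<Rightarrow> ('b \<Rightarrow>\<^sub>0 complex) set"
  where "lin_on B = {f. Poly_Mapping.keys f \<subseteq> B}"

definition lin_scale :: "complex \<Rightarrow> ('b \<Rightarrow>\<^sub>0 complex) \<Rightarrow> ('b \<Rightarrow>\<^sub>0 complex)"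
  where "lin_scale z f = Poly_Mapping.map ((*) z) f"

text \<open>The bilinear extension of a composition and the conjugate-linear extension of an adjoint.\<close>

definition lin_comp :: "('b \<Rightarrow> 'b \<Rightarrow> 'b) \<Rightarrow> ('b \<Rightarrow>\<^sub>0 complex) \<Rightarrow> ('b \<Rightarrow>\<^sub>0 complex) \<Rightarrow> ('b \<Rightarrow>\<^sub>0 complex)"
  where "lin_comp c g f =
    (\<Sum>y\<in>Poly_Mapping.keys g. \<Sum>x\<in>Poly_Mapping.keys f.
      Poly_Mapping.single (c y x) (Poly_Mapping.lookup g y * Poly_Mapping.lookup f x))"

definition lin_adj :: "('b \<Rightarrow> 'b) \<Rightarrow> ('b \<Rightarrow>\<^sub>0 complex) \<Rightarrow> ('b \<Rightarrow>\<^sub>0 complex)"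
  where "lin_adj s f =
    (\<Sum>x\<in>Poly_Mapping.keys f. Poly_Mapping.single (s x) (cnj (Poly_Mapping.lookup f x)))"

section \<open>The rectangular planar rook category\<close>

text \<open>
  An isotopy class of diagrams is recorded by its strings, each string being the set of marked
  points that it meets. Marked points are numbered from the left, starting with 1; \<open>Mid\<close> points
  occur only while two diagrams are being stacked.
\<close>

datatype point = Bot nat | Mid nat | Top nat

text \<open>
  Strings meeting only one marked point can be retracted to it, so the only obstruction to drawing
  the strings disjointly is a pair of strings from bottom to top in opposite order.
\<close>

definition rook_diagram :: "nat \<Rightarrow> nat \<Rightarrow> point set set \<Rightarrow> bool"
  where "rook_diagram m n D \<longleftrightarrow>
    partition_on (Bot ` {1..m} \<union> Top ` {1..n}) D \<and>
    (\<forall>s\<in>D. card s = 1 \<or> card s = 2) \<and>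
    (\<forall>s\<in>D. \<forall>i i'. Bot i \<in> s \<and> Bot i' \<in> s \<longrightarrow> i = i') \<and>
    (\<forall>s\<in>D. \<forall>j j'. Top j \<in> s \<and> Top j' \<in> s \<longrightarrow> j = j') \<and>
    (\<forall>s\<in>D. \<forall>s'\<in>D. \<forall>i j i' j'.
      Bot i \<in> s \<and> Top j \<in> s \<and> Bot i' \<in> s' \<and> Top j' \<in> s' \<and> i < i' \<longrightarrow> j < j')"

primrec top_to_mid :: "point \<Rightarrow> point" where
  "top_to_mid (Bot i) = Bot i"
| "top_to_mid (Mid i) = Mid i"
| "top_to_mid (Top i) = Mid i"

primrec bot_to_mid :: "point \<Rightarrow> point" where
  "bot_to_mid (Bot i) = Mid i"
| "bot_to_mid (Mid i) = Mid i"
| "bot_to_mid (Top i) = Top i"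

primrec flip_point :: "point \<Rightarrow> point" where
  "flip_point (Bot i) = Top i"
| "flip_point (Mid i) = Mid i"
| "flip_point (Top i) = Bot i"

definition on_common_string :: "point set set \<Rightarrow> (point \<times> point) set"
  where "on_common_string S = {(x, y). \<exists>s\<in>S. x \<in> s \<and> y \<in> s}"

text \<open>
  \<open>stack E D\<close> puts \<open>E\<close> on top of \<open>D\<close>. Its strings are the connected components of the glued picture
  that reach the bottom or the top; the components contained in the middle are the floating strings.
\<close>

definition stack :: "point set set \<Rightarrow> point set set \<Rightarrow> point set set"
  where "stack E D =
    (let S = (`) top_to_mid ` D \<union> (`) bot_to_mid ` E
     in (\<lambda>x. (on_common_string S)\<^sup>* `` {x} - range Mid) ` (\<Union>S - range Mid))"

definition reflect :: "point set set \<Rightarrow> point set set"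
  where "reflect D = (`) flip_point ` D"

definition id_diagram :: "nat \<Rightarrow> point set set"
  where "id_diagram n = (\<lambda>i. {Bot i, Top i}) ` {1..n}"

definition RP :: "(nat, point set set \<Rightarrow>\<^sub>0 complex) star_cat"
  where "RP = \<lparr>
    Obj = UNIV,
    Hom = (\<lambda>m n. lin_on {D. rook_diagram m n D}),
    cid = (\<lambda>n. Poly_Mapping.single (id_diagram n) 1),
    ccomp = (\<lambda>m n p. lin_comp stack),
    cscale = lin_scale,
    cadj = (\<lambda>m n. lin_adj reflect)\<rparr>"

section \<open>The annular GICAR category\<close>

datatype letter = Alpha nat | AlphaStar nat | Tau | TauStar

text \<open>
  \<open>ag_word m n w\<close>: the word \<open>w\<close> is a composable word from \<open>[m]\<close> to \<open>[n]\<close>. As in a composite of maps,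
  the last letter of the list is applied first.
\<close>

inductive ag_word :: "nat \<Rightarrow> nat \<Rightarrow> letter list \<Rightarrow> bool" where
  "ag_word n n []"
| "\<lbrakk>ag_word m n w; 1 \<le> i; i \<le> n + 1\<rbrakk> \<Longrightarrow> ag_word m (n + 1) (Alpha i # w)"
| "\<lbrakk>ag_word m (n + 1) w; 1 \<le> i; i \<le> n + 1\<rbrakk> \<Longrightarrow> ag_word m n (AlphaStar i # w)"
| "ag_word m n w \<Longrightarrow> ag_word m n (Tau # w)"
| "ag_word m n w \<Longrightarrow> ag_word m n (TauStar # w)"

primrec letter_adj :: "letter \<Rightarrow> letter" where
  "letter_adj (Alpha i) = AlphaStar i"
| "letter_adj (AlphaStar i) = Alpha i"
| "letter_adj Tau = TauStar"
| "letter_adj TauStar = Tau"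

definition word_adj :: "letter list \<Rightarrow> letter list"
  where "word_adj w = rev (map letter_adj w)"

text \<open>The defining relations between words from \<open>[m]\<close> to \<open>[n]\<close>. Since \<open>\<tau>\<^sup>0 = id\<close> is void,
  \<open>\<tau> = id\<close> on \<open>[0]\<close> is a relation of its own.\<close>

inductive ag_rel :: "nat \<Rightarrow> nat \<Rightarrow> letter list \<Rightarrow> letter list \<Rightarrow> bool" where
  AG1: "\<lbrakk>1 \<le> i; i < j; j \<le> n + 2\<rbrakk>
    \<Longrightarrow> ag_rel n (n + 2) [Alpha i, Alpha (j - 1)] [Alpha j, Alpha i]"
| AG1_star: "\<lbrakk>1 \<le> i; i < j; j \<le> n + 2\<rbrakk>
    \<Longrightarrow> ag_rel (n + 2) n [AlphaStar i, AlphaStar j] [AlphaStar (j - 1), AlphaStar i]"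
| AG2_less: "\<lbrakk>1 \<le> i; i < j; j \<le> n + 1\<rbrakk>
    \<Longrightarrow> ag_rel n n [AlphaStar i, Alpha j] [Alpha (j - 1), AlphaStar i]"
| AG2_eq: "\<lbrakk>1 \<le> i; i \<le> n + 1\<rbrakk> \<Longrightarrow> ag_rel n n [AlphaStar i, Alpha i] []"
| AG2_greater: "\<lbrakk>1 \<le> j; j < i; i \<le> n + 1\<rbrakk>
    \<Longrightarrow> ag_rel n n [AlphaStar i, Alpha j] [Alpha j, AlphaStar (i - 1)]"
| AG3_inv_left: "ag_rel n n [TauStar, Tau] []"
| AG3_inv_right: "ag_rel n n [Tau, TauStar] []"
| AG3_order: "ag_rel n n (replicate n Tau) []"
| AG3_zero: "ag_rel 0 0 [Tau] []"
| AG4: "\<lbrakk>2 \<le> i; i \<le> n\<rbrakk> \<Longrightarrow> ag_rel (n - 1) n [Alpha i, Tau] [Tau, Alpha (i - 1)]"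
| AG4_star: "\<lbrakk>2 \<le> i; i \<le> n\<rbrakk>
    \<Longrightarrow> ag_rel n (n - 1) [AlphaStar i, Tau] [Tau, AlphaStar (i - 1)]"

text \<open>The smallest congruence on words that contains the relations and respects adjoints.\<close>

inductive ag_eq :: "nat \<Rightarrow> nat \<Rightarrow> letter list \<Rightarrow> letter list \<Rightarrow> bool" where
  rel: "ag_rel m n u v \<Longrightarrow> ag_eq m n u v"
| refl: "ag_word m n u \<Longrightarrow> ag_eq m n u u"
| sym: "ag_eq m n u v \<Longrightarrow> ag_eq m n v u"
| trans: "\<lbrakk>ag_eq m n u v; ag_eq m n v w\<rbrakk> \<Longrightarrow> ag_eq m n u w"
| comp: "\<lbrakk>ag_eq n p u u'; ag_eq m n v v'\<rbrakk> \<Longrightarrow> ag_eq m p (u @ v) (u' @ v')"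
| adj: "ag_eq m n u v \<Longrightarrow> ag_eq n m (word_adj u) (word_adj v)"

definition ag_cong :: "nat \<Rightarrow> nat \<Rightarrow> (letter list \<times> letter list) set"
  where "ag_cong m n = {(u, v). ag_eq m n u v}"

definition ag_classes :: "nat \<Rightarrow> nat \<Rightarrow> letter list set set"
  where "ag_classes m n = {w. ag_word m n w} // ag_cong m n"

definition class_comp :: "nat \<Rightarrow> nat \<Rightarrow> letter list set \<Rightarrow> letter list set \<Rightarrow> letter list set"
  where "class_comp m p X Y = ag_cong m p `` {u @ v |u v. u \<in> X \<and> v \<in> Y}"

definition class_adj :: "nat \<Rightarrow> nat \<Rightarrow> letter list set \<Rightarrow> letter list set"
  where "class_adj m n X = ag_cong n m `` (word_adj ` X)"

definition AG :: "(nat, letter list set \<Rightarrow>\<^sub>0 complex) star_cat"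
  where "AG = \<lparr>
    Obj = UNIV,
    Hom = (\<lambda>m n. lin_on (ag_classes m n)),
    cid = (\<lambda>n. Poly_Mapping.single (ag_cong n n `` {[]}) 1),
    ccomp = (\<lambda>m n p. lin_comp (class_comp m p)),
    cscale = lin_scale,
    cadj = (\<lambda>m n. lin_adj (class_adj m n))\<rparr>"

section \<open>The rectangular GICAR category\<close>

definition standard_form :: "nat \<Rightarrow> nat \<Rightarrow> letter list \<Rightarrow> bool"
  where "standard_form m n w \<longleftrightarrow> ag_word m n w \<and>
    (\<exists>is r js. w = map Alpha (rev is) @ replicate r Tau @ map AlphaStar js \<and>
      sorted_wrt (<) is \<and> sorted_wrt (<) js \<and>
      (r < m - length js \<or> m = length js \<and> r = 0))"

definition tau_free_classes :: "nat \<Rightarrow> nat \<Rightarrow> letter list set set"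
  where "tau_free_classes m n =
    {X \<in> ag_classes m n. \<exists>w\<in>X. standard_form m n w \<and> Tau \<notin> set w}"

definition RG :: "(nat, letter list set \<Rightarrow>\<^sub>0 complex) star_cat"
  where "RG = AG\<lparr>Hom := (\<lambda>m n. lin_on (tau_free_classes m n))\<rparr>"

end

theory Submission
  imports Defs
begin

text \<open>
  Both categories are linearisations of one and the same category with involution, that of
  order-preserving partial injections \<open>{1..m} \<rightharpoonup> {1..n}\<close>, here taken as relations. A rook diagram
  is determined by the relation given by its through strings. A word of \<open>AG\<close> acts by a partial
  injection, \<open>\<tau>\<close> by a cyclic rotation; this respects the relations. The relations bring a word
  without \<open>\<tau>\<close> into a standard form without \<open>\<tau>\<close>, whose indices are the points that are missing from
  the range and the domain of its partial injection; hence such words are equal in \<open>AG\<close> as soon as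
  they act in the same way. Conversely every order-preserving partial injection comes from such a
  word, by induction on its last points.
\<close>

section \<open>Linearisation of a category with involution\<close>

text \<open>Two rectangular words might be identified in \<open>AG\<close> by a chain of relations
  passing through words with \<tau>. Rewriting confined to rectangular words cannot exclude this, so
  the action is defined on all words, rotations included, and serves as an invariant of
  \<open>ag_eq\<close>. For the converse, normal forms are needed for rectangular words only: an
  order-preserving partial injection is determined by its domain and range, so both index lists can
  be read off from the action. No classification of annular words enters. It is not evident either
  that classes with a \<tau>-free standard form are closed under composition, or that stacking is
  associative. Neither is checked directly: relations under \<open>O\<close> and converse satisfy
  the axioms at once, and bijections compatible with the operations carry the axioms over. The
  resulting functors fix objects and are bijective on basis morphisms, so the equivalence is in fact
  an isomorphism.\<close>

definition lin_cat ::
  "(nat \<Rightarrow> nat \<Rightarrow> 'b set) \<Rightarrow> (nat \<Rightarrow> 'b) \<Rightarrow> (nat \<Rightarrow> nat \<Rightarrow> nat \<Rightarrow> 'b \<Rightarrow> 'b \<Rightarrow> 'b)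
    \<Rightarrow> (nat \<Rightarrow> nat \<Rightarrow> 'b \<Rightarrow> 'b) \<Rightarrow> (nat, 'b \<Rightarrow>\<^sub>0 complex) star_cat"
  where "lin_cat B e c s = \<lparr>
    Obj = UNIV,
    Hom = (\<lambda>m n. lin_on (B m n)),
    cid = (\<lambda>n. Poly_Mapping.single (e n) 1),
    ccomp = (\<lambda>m n p. lin_comp (c m n p)),
    cscale = lin_scale,
    cadj = (\<lambda>m n. lin_adj (s m n))\<rparr>"

definition lin_ext :: "('a \<Rightarrow> 'b) \<Rightarrow> ('a \<Rightarrow>\<^sub>0 complex) \<Rightarrow> ('b \<Rightarrow>\<^sub>0 complex)"
  where "lin_ext f p =
    (\<Sum>x\<in>Poly_Mapping.keys p. Poly_Mapping.single (f x) (Poly_Mapping.lookup p x))"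

section \<open>Linear, bilinear and conjugate-linear extension\<close>

lemma lookup_lin_scale [simp]:
  "Poly_Mapping.lookup (lin_scale z f) x = z * Poly_Mapping.lookup f x"
  by (simp add: lin_scale_def Poly_Mapping.map.rep_eq when_def)

lemma lin_scale_single [simp]: "lin_scale z (Poly_Mapping.single x w) = Poly_Mapping.single x (z * w)"
  by (rule poly_mapping_eqI) (simp add: lookup_single when_def)

lemma lin_scale_zero [simp]: "lin_scale z 0 = 0"
  by (rule poly_mapping_eqI) simp

lemma lin_scale_add: "lin_scale z (f + g) = lin_scale z f + lin_scale z g"
  by (rule poly_mapping_eqI) (simp add: lookup_add algebra_simps)

lemma vector_space_lin_scale: "vector_space lin_scale"
  by unfold_locales (auto intro!: poly_mapping_eqI simp: lookup_add algebra_simps)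

lemma keys_lin_scale: "Poly_Mapping.keys (lin_scale z f) \<subseteq> Poly_Mapping.keys f"
  by (auto simp: in_keys_iff)

lemma lin_on_zero: "0 \<in> lin_on B"
  by (simp add: lin_on_def)

lemma lin_on_single: "x \<in> B \<Longrightarrow> Poly_Mapping.single x z \<in> lin_on B"
  by (simp add: lin_on_def)

lemma lin_on_add: "\<lbrakk>f \<in> lin_on B; g \<in> lin_on B\<rbrakk> \<Longrightarrow> f + g \<in> lin_on B"
  using Poly_Mapping.keys_add[of f g] by (auto simp: lin_on_def)

lemma lin_on_scale: "f \<in> lin_on B \<Longrightarrow> lin_scale z f \<in> lin_on B"
  using keys_lin_scale[of z f] by (auto simp: lin_on_def)

lemma subspace_lin_on: "module.subspace lin_scale (lin_on B)"
proof -
  interpret vector_space lin_scale by (rule vector_space_lin_scale)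
  show ?thesis by (auto simp: subspace_def lin_on_zero lin_on_add lin_on_scale)
qed

text \<open>An element is the finite sum of its singletons. The coefficient \<open>z\<close> is
  arbitrary, so additive identities reduce to basis elements without a scalar case; this serves
  linear and conjugate-linear extensions alike.\<close>

lemma lin_on_induct [consumes 1, case_names zero single add]:
  assumes "f \<in> lin_on B"
    and "P 0"
    and "\<And>x z. x \<in> B \<Longrightarrow> P (Poly_Mapping.single x z)"
    and add: "\<And>f g. \<lbrakk>f \<in> lin_on B; g \<in> lin_on B; P f; P g\<rbrakk> \<Longrightarrow> P (f + g)"
  shows "P f"
proof -
  have "P (\<Sum>x\<in>A. Poly_Mapping.single x (Poly_Mapping.lookup f x)) \<and>
      (\<Sum>x\<in>A. Poly_Mapping.single x (Poly_Mapping.lookup f x)) \<in> lin_on B"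
    if "finite A" "A \<subseteq> B" for A
    using that by (induction A) (auto simp: assms lin_on_zero lin_on_add lin_on_single)
  moreover have "f = (\<Sum>x\<in>Poly_Mapping.keys f. Poly_Mapping.single x (Poly_Mapping.lookup f x))"
    by (rule poly_mapping_eqI)
      (simp add: lookup_sum lookup_single when_def in_keys_iff)
  ultimately show ?thesis
    using assms(1) by (metis finite_keys lin_on_def mem_Collect_eq)
qed

text \<open>Cancellation can make the keys of \<open>p + q\<close> fewer than those of
  \<open>p\<close> and \<open>q\<close> together. Padding all sums with zero terms over one common
  finite set turns additivity into distributivity of sums; the next two lemmas serve the same
  end.\<close>

lemma lin_ext_superset:
  assumes "finite A" "Poly_Mapping.keys p \<subseteq> A"
  shows "lin_ext f p = (\<Sum>x\<in>A. Poly_Mapping.single (f x) (Poly_Mapping.lookup p x))"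
  unfolding lin_ext_def by (rule sum.mono_neutral_left) (use assms in \<open>auto simp: in_keys_iff\<close>)

lemma lin_adj_superset:
  assumes "finite A" "Poly_Mapping.keys p \<subseteq> A"
  shows "lin_adj f p = (\<Sum>x\<in>A. Poly_Mapping.single (f x) (cnj (Poly_Mapping.lookup p x)))"
  unfolding lin_adj_def by (rule sum.mono_neutral_left) (use assms in \<open>auto simp: in_keys_iff\<close>)

lemma lin_comp_superset:
  assumes "finite A" "Poly_Mapping.keys g \<subseteq> A" "finite A'" "Poly_Mapping.keys f \<subseteq> A'"
  shows "lin_comp c g f = (\<Sum>y\<in>A. \<Sum>x\<in>A'.
    Poly_Mapping.single (c y x) (Poly_Mapping.lookup g y * Poly_Mapping.lookup f x))"
proof -
  have "(\<Sum>x\<in>A'. Poly_Mapping.single (c y x) (Poly_Mapping.lookup g y * Poly_Mapping.lookup f x)) =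
      (\<Sum>x\<in>Poly_Mapping.keys f.
        Poly_Mapping.single (c y x) (Poly_Mapping.lookup g y * Poly_Mapping.lookup f x))" for y
    by (rule sum.mono_neutral_right) (use assms in \<open>auto simp: in_keys_iff\<close>)
  then show ?thesis
    unfolding lin_comp_def
    by (simp, intro sum.mono_neutral_left) (use assms in \<open>auto simp: in_keys_iff\<close>)
qed

lemma lin_ext_zero [simp]: "lin_ext f 0 = 0"
  by (simp add: lin_ext_def)

lemma lin_ext_single [simp]: "lin_ext f (Poly_Mapping.single x z) = Poly_Mapping.single (f x) z"
  by (subst lin_ext_superset[of "{x}"]) auto

lemma lin_ext_add: "lin_ext f (p + q) = lin_ext f p + lin_ext f q"
  by (subst (1 2 3) lin_ext_superset[of "Poly_Mapping.keys p \<union> Poly_Mapping.keys q"])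
    (use Poly_Mapping.keys_add[of p q] in \<open>auto simp: lookup_add single_add sum.distrib\<close>)

lemma lin_adj_zero [simp]: "lin_adj f 0 = 0"
  by (simp add: lin_adj_def)

lemma lin_adj_single [simp]:
  "lin_adj f (Poly_Mapping.single x z) = Poly_Mapping.single (f x) (cnj z)"
  by (subst lin_adj_superset[of "{x}"]) auto

lemma lin_adj_add: "lin_adj f (p + q) = lin_adj f p + lin_adj f q"
  by (subst (1 2 3) lin_adj_superset[of "Poly_Mapping.keys p \<union> Poly_Mapping.keys q"])
    (use Poly_Mapping.keys_add[of p q] in \<open>auto simp: lookup_add single_add sum.distrib\<close>)

lemma lin_comp_zero [simp]: "lin_comp c 0 f = 0" "lin_comp c g 0 = 0"
  by (simp_all add: lin_comp_def)

lemma lin_comp_single [simp]: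
  "lin_comp c (Poly_Mapping.single y w) (Poly_Mapping.single x z) =
    Poly_Mapping.single (c y x) (w * z)"
  by (subst lin_comp_superset[of "{y}" _ "{x}"]) auto

lemma lin_comp_add_left: "lin_comp c (g + g') f = lin_comp c g f + lin_comp c g' f"
  by (subst (1 2 3) lin_comp_superset
      [of "Poly_Mapping.keys g \<union> Poly_Mapping.keys g'" _ "Poly_Mapping.keys f"])
    (use Poly_Mapping.keys_add[of g g'] in
      \<open>auto simp: lookup_add single_add sum.distrib algebra_simps\<close>)

lemma lin_comp_add_right: "lin_comp c g (f + f') = lin_comp c g f + lin_comp c g f'"
  by (subst (1 2 3) lin_comp_superset
      [of "Poly_Mapping.keys g" _ "Poly_Mapping.keys f \<union> Poly_Mapping.keys f'"])
    (use Poly_Mapping.keys_add[of f f'] in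
      \<open>auto simp: lookup_add single_add sum.distrib algebra_simps\<close>)

lemmas lin_additive = lin_ext_add lin_adj_add lin_comp_add_left lin_comp_add_right lin_scale_add

lemma lin_on_UNIV: "f \<in> lin_on UNIV"
  by (simp add: lin_on_def)

lemma lin_comp_scale_left: "lin_comp c (lin_scale z g) f = lin_scale z (lin_comp c g f)"
  using lin_on_UNIV[of g]
proof (induction g rule: lin_on_induct)
  case (single y w)
  show ?case using lin_on_UNIV[of f]
    by (induction f rule: lin_on_induct) (auto simp: lin_additive algebra_simps)
qed (auto simp: lin_additive)

lemma lin_comp_scale_right: "lin_comp c g (lin_scale z f) = lin_scale z (lin_comp c g f)"
  using lin_on_UNIV[of g]
proof (induction g rule: lin_on_induct)
  case (single y w)
  show ?case using lin_on_UNIV[of f]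
    by (induction f rule: lin_on_induct) (auto simp: lin_additive algebra_simps)
qed (auto simp: lin_additive)

lemma lin_ext_scale: "lin_ext f (lin_scale z p) = lin_scale z (lin_ext f p)"
  using lin_on_UNIV[of p]
  by (induction p rule: lin_on_induct) (auto simp: lin_additive)

lemma lin_adj_scale: "lin_adj f (lin_scale z p) = lin_scale (cnj z) (lin_adj f p)"
  using lin_on_UNIV[of p]
  by (induction p rule: lin_on_induct) (auto simp: lin_additive)

section \<open>Categories with involution before linearisation\<close>

locale basis_star_category =
  fixes B :: "nat \<Rightarrow> nat \<Rightarrow> 'b set" and e :: "nat \<Rightarrow> 'b"
    and c :: "nat \<Rightarrow> nat \<Rightarrow> nat \<Rightarrow> 'b \<Rightarrow> 'b \<Rightarrow> 'b" and s :: "nat \<Rightarrow> nat \<Rightarrow> 'b \<Rightarrow> 'b"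
  assumes id_in: "e n \<in> B n n"
    and comp_in: "\<lbrakk>x \<in> B m n; y \<in> B n p\<rbrakk> \<Longrightarrow> c m n p y x \<in> B m p"
    and id_right: "x \<in> B m n \<Longrightarrow> c m m n x (e m) = x"
    and id_left: "x \<in> B m n \<Longrightarrow> c m n n (e n) x = x"
    and assoc: "\<lbrakk>x \<in> B m n; y \<in> B n p; z \<in> B p q\<rbrakk>
      \<Longrightarrow> c m p q z (c m n p y x) = c m n q (c n p q z y) x"
    and star_in: "x \<in> B m n \<Longrightarrow> s m n x \<in> B n m"
    and star_star: "x \<in> B m n \<Longrightarrow> s n m (s m n x) = x"
    and star_comp: "\<lbrakk>x \<in> B m n; y \<in> B n p\<rbrakk>
      \<Longrightarrow> s m p (c m n p y x) = c p n m (s m n x) (s n p y)"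
    and star_id: "s n n (e n) = e n"
begin

lemma lin_comp_in:
  assumes "f \<in> lin_on (B m n)" "g \<in> lin_on (B n p)"
  shows "lin_comp (c m n p) g f \<in> lin_on (B m p)"
  using assms(2)
proof (induction g rule: lin_on_induct)
  case (single y w)
  show ?case using assms(1)
    by (induction f rule: lin_on_induct)
      (auto simp: lin_additive lin_on_zero lin_on_add intro!: lin_on_single comp_in single)
qed (auto simp: lin_additive lin_on_zero lin_on_add)

lemma lin_comp_assoc:
  assumes "f \<in> lin_on (B m n)" "g \<in> lin_on (B n p)" "h \<in> lin_on (B p q)"
  shows "lin_comp (c m p q) h (lin_comp (c m n p) g f) =
    lin_comp (c m n q) (lin_comp (c n p q) h g) f"
  using assms(3)
proof (induction h rule: lin_on_induct)
  case h: (single z u)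
  show ?case using assms(2)
  proof (induction g rule: lin_on_induct)
    case g: (single y w)
    show ?case using assms(1)
      by (induction f rule: lin_on_induct)
        (auto simp: lin_additive assoc[OF _ g h] mult.assoc)
  qed (auto simp: lin_additive)
qed (auto simp: lin_additive)

lemma lin_adj_comp:
  assumes "f \<in> lin_on (B m n)" "g \<in> lin_on (B n p)"
  shows "lin_adj (s m p) (lin_comp (c m n p) g f) =
    lin_comp (c p n m) (lin_adj (s m n) f) (lin_adj (s n p) g)"
  using assms(2)
proof (induction g rule: lin_on_induct)
  case (single y w)
  show ?case using assms(1)
    by (induction f rule: lin_on_induct)
      (auto simp: lin_additive star_comp[OF _ single] mult.commute)
qed (auto simp: lin_additive)

lemma linear_star_category_lin_cat: "linear_star_category (lin_cat B e c s)"
proof (intro linear_star_category.intro, unfold lin_cat_def star_cat.simps)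
  show "vector_space lin_scale" by (rule vector_space_lin_scale)
  show "module.subspace lin_scale (lin_on (B a b))" for a b by (rule subspace_lin_on)
  show "Poly_Mapping.single (e a) 1 \<in> lin_on (B a a)" for a by (simp add: lin_on_single id_in)
  fix a b d q f f' g h z
  assume f: "f \<in> lin_on (B a b)"
  show "lin_comp (c a a b) f (Poly_Mapping.single (e a) 1) = f"
    using f by (induction f rule: lin_on_induct) (auto simp: lin_additive id_right)
  show "lin_comp (c a b b) (Poly_Mapping.single (e b) 1) f = f"
    using f by (induction f rule: lin_on_induct) (auto simp: lin_additive id_left)
  show "lin_adj (s a b) f \<in> lin_on (B b a)"
    using f by (induction f rule: lin_on_induct)
      (auto simp: lin_additive lin_on_zero lin_on_add intro!: lin_on_single star_in)
  show "lin_adj (s b a) (lin_adj (s a b) f) = f"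
    using f by (induction f rule: lin_on_induct) (auto simp: lin_additive star_star)
  show "lin_adj (s a b) (lin_scale z f) = lin_scale (cnj z) (lin_adj (s a b) f)"
    by (rule lin_adj_scale)
  show "lin_adj (s a b) (f + f') = lin_adj (s a b) f + lin_adj (s a b) f'"
    by (rule lin_adj_add)
  assume g: "g \<in> lin_on (B b d)"
  show "lin_comp (c a b d) g f \<in> lin_on (B a d)" by (rule lin_comp_in[OF f g])
  show "lin_adj (s a d) (lin_comp (c a b d) g f) =
      lin_comp (c d b a) (lin_adj (s a b) f) (lin_adj (s b d) g)"
    by (rule lin_adj_comp[OF f g])
  show "lin_comp (c a b d) g (f + f') = lin_comp (c a b d) g f + lin_comp (c a b d) g f'"
    by (rule lin_comp_add_right)
  show "lin_comp (c a b d) (g + g') f = lin_comp (c a b d) g f + lin_comp (c a b d) g' f" for g'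
    by (rule lin_comp_add_left)
  show "lin_comp (c a b d) g (lin_scale z f) = lin_scale z (lin_comp (c a b d) g f)"
    by (rule lin_comp_scale_right)
  show "lin_comp (c a b d) (lin_scale z g) f = lin_scale z (lin_comp (c a b d) g f)"
    by (rule lin_comp_scale_left)
  assume h: "h \<in> lin_on (B d q)"
  show "lin_comp (c a d q) h (lin_comp (c a b d) g f) =
      lin_comp (c a b q) (lin_comp (c b d q) h g) f"
    by (rule lin_comp_assoc[OF f g h])
qed

end

section \<open>Isomorphisms on basis morphisms and the equivalences they induce\<close>

locale basis_star_iso = basis_star_category B e c s
  for B :: "nat \<Rightarrow> nat \<Rightarrow> 'b set" and e c s +
  fixes B' :: "nat \<Rightarrow> nat \<Rightarrow> 'd set" and e' :: "nat \<Rightarrow> 'd"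
    and c' :: "nat \<Rightarrow> nat \<Rightarrow> nat \<Rightarrow> 'd \<Rightarrow> 'd \<Rightarrow> 'd" and s' :: "nat \<Rightarrow> nat \<Rightarrow> 'd \<Rightarrow> 'd"
    and \<phi> :: "nat \<Rightarrow> nat \<Rightarrow> 'b \<Rightarrow> 'd"
  assumes bij: "bij_betw (\<phi> m n) (B m n) (B' m n)"
    and map_id: "\<phi> n n (e n) = e' n"
    and map_comp: "\<lbrakk>x \<in> B m n; y \<in> B n p\<rbrakk>
      \<Longrightarrow> \<phi> m p (c m n p y x) = c' m n p (\<phi> n p y) (\<phi> m n x)"
    and map_star: "x \<in> B m n \<Longrightarrow> \<phi> n m (s m n x) = s' m n (\<phi> m n x)"
begin

abbreviation \<psi> :: "nat \<Rightarrow> nat \<Rightarrow> 'd \<Rightarrow> 'b"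
  where "\<psi> m n \<equiv> inv_into (B m n) (\<phi> m n)"

lemma map_in: "x \<in> B m n \<Longrightarrow> \<phi> m n x \<in> B' m n"
  using bij by (rule bij_betwE[rule_format])

lemma image_cases:
  assumes "y \<in> B' m n"
  obtains x where "x \<in> B m n" "y = \<phi> m n x"
  using assms bij[of m n] by (auto simp: bij_betw_def)

lemma inv_map [simp]: "x \<in> B m n \<Longrightarrow> \<psi> m n (\<phi> m n x) = x"
  using bij[of m n] by (auto simp: bij_betw_def)

text \<open>Transport of structure: each element of \<open>B'\<close> is an image under \<phi>, and
  \<phi> respects all operations. Nothing is assumed about \<open>B'\<close> beforehand, so this is
  how diagrams and word classes are shown to form categories.\<close>

lemma target_basis_star_category: "basis_star_category B' e' c' s'"
proof
  show "e' n \<in> B' n n" for n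
    unfolding map_id[symmetric] by (intro map_in id_in)
  show "s' n n (e' n) = e' n" for n
    unfolding map_id[symmetric] by (simp add: map_star[symmetric] id_in star_id)
  fix m n p q x y z assume "x \<in> B' m n"
  then obtain x0 where x: "x0 \<in> B m n" "x = \<phi> m n x0" by (rule image_cases)
  show "c' m m n x (e' m) = x" "c' m n n (e' n) x = x"
    unfolding map_id[symmetric] x(2)
    by (simp_all add: map_comp[symmetric] x id_in id_left id_right)
  show "s' m n x \<in> B' n m" "s' n m (s' m n x) = x"
    by (simp_all add: x map_star[symmetric] star_in star_star map_in)
  assume "y \<in> B' n p"
  then obtain y0 where y: "y0 \<in> B n p" "y = \<phi> n p y0" by (rule image_cases)
  show "c' m n p y x \<in> B' m p"
    by (simp add: x y map_comp[symmetric] comp_in map_in)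
  show "s' m p (c' m n p y x) = c' p n m (s' m n x) (s' n p y)"
    by (metis x y map_comp map_star comp_in star_in star_comp)
  assume "z \<in> B' p q"
  then obtain z0 where z: "z0 \<in> B p q" "z = \<phi> p q z0" by (rule image_cases)
  show "c' m p q z (c' m n p y x) = c' m n q (c' n p q z y) x"
    by (metis x y z map_comp comp_in assoc)
qed

lemma inverse_iso: "basis_star_iso B' e' c' s' B e c s \<psi>"
proof -
  interpret T: basis_star_category B' e' c' s' by (rule target_basis_star_category)
  show ?thesis
  proof
    show "bij_betw (\<psi> m n) (B' m n) (B m n)" for m n by (rule bij_betw_inv_into[OF bij])
    show "\<psi> n n (e' n) = e n" for n by (simp add: map_id[symmetric] id_in)
    fix m n p x y assume "x \<in> B' m n"
    then obtain x0 where x: "x0 \<in> B m n" "x = \<phi> m n x0" by (rule image_cases)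
    show "\<psi> n m (s' m n x) = s m n (\<psi> m n x)"
      by (simp add: x map_star[symmetric] star_in)
    assume "y \<in> B' n p"
    then obtain y0 where y: "y0 \<in> B n p" "y = \<phi> n p y0" by (rule image_cases)
    show "\<psi> m p (c' m n p y x) = c m n p (\<psi> n p y) (\<psi> m n x)"
      by (simp add: x y map_comp[symmetric] comp_in)
  qed
qed

lemma star_functor_lin_ext:
  "star_functor (lin_cat B e c s) (lin_cat B' e' c' s') (\<lambda>n. n) (\<lambda>m n. lin_ext (\<phi> m n))"
proof (unfold_locales, unfold lin_cat_def star_cat.simps)
  show "lin_ext (\<phi> a a) (Poly_Mapping.single (e a) 1) = Poly_Mapping.single (e' a) 1" for a
    by (simp add: map_id)
  fix a b d f f' g z
  assume f: "f \<in> lin_on (B a b)"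
  show "lin_ext (\<phi> a b) f \<in> lin_on (B' a b)"
    using f by (induction f rule: lin_on_induct)
      (auto simp: lin_additive lin_on_zero lin_on_add intro!: lin_on_single map_in)
  show "lin_ext (\<phi> b a) (lin_adj (s a b) f) = lin_adj (s' a b) (lin_ext (\<phi> a b) f)"
    using f by (induction f rule: lin_on_induct) (auto simp: lin_additive map_star)
  show "lin_ext (\<phi> a b) (f + f') = lin_ext (\<phi> a b) f + lin_ext (\<phi> a b) f'"
    by (rule lin_ext_add)
  show "lin_ext (\<phi> a b) (lin_scale z f) = lin_scale z (lin_ext (\<phi> a b) f)"
    by (rule lin_ext_scale)
  assume "g \<in> lin_on (B b d)"
  then show "lin_ext (\<phi> a d) (lin_comp (c a b d) g f) =
      lin_comp (c' a b d) (lin_ext (\<phi> b d) g) (lin_ext (\<phi> a b) f)"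
  proof (induction g rule: lin_on_induct)
    case (single y w)
    show ?case using f
      by (induction f rule: lin_on_induct) (auto simp: lin_additive map_comp[OF _ single])
  qed (auto simp: lin_additive)
qed auto

lemma lin_ext_inv_map:
  assumes "f \<in> lin_on (B m n)"
  shows "lin_ext (\<psi> m n) (lin_ext (\<phi> m n) f) = f"
  using assms by (induction f rule: lin_on_induct) (auto simp: lin_additive)

lemma lin_ext_map_inv:
  assumes "f \<in> lin_on (B' m n)"
  shows "lin_ext (\<phi> m n) (lin_ext (\<psi> m n) f) = f"
  using assms by (induction f rule: lin_on_induct)
    (auto simp: lin_additive elim!: image_cases)

text \<open>Both functors are left free because the identity functor is the source of the unit but
  the target of the counit; each composite agrees with it only on the morphism spaces. The component
  is an identity, unitary by \<open>star_id\<close>.\<close>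

lemma unitary_nat_iso_lin_cat_id:
  assumes "\<And>m n f. f \<in> lin_on (B m n) \<Longrightarrow> Fm m n f = f \<and> Gm m n f = f"
  shows "unitary_nat_iso (lin_cat B e c s) (lin_cat B e c s) (\<lambda>n. n) Fm (\<lambda>n. n) Gm
    (\<lambda>n. Poly_Mapping.single (e n) 1)"
proof -
  interpret L: linear_star_category "lin_cat B e c s" by (rule linear_star_category_lin_cat)
  show ?thesis
    using L.comp_id_left L.comp_id_right
    by (auto simp: unitary_nat_iso_def lin_cat_def assms id_in id_left star_id lin_on_single)
qed

lemma star_equivalent_lin_cat: "star_equivalent (lin_cat B e c s) (lin_cat B' e' c' s')"
proof -
  interpret I: basis_star_iso B' e' c' s' B e c s \<psi> by (rule inverse_iso)
  show ?thesis
    unfolding star_equivalent_def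
  proof (intro conjI exI)
    show "linear_star_category (lin_cat B e c s)" "linear_star_category (lin_cat B' e' c' s')"
      by (rule linear_star_category_lin_cat I.linear_star_category_lin_cat)+
    show "star_functor (lin_cat B e c s) (lin_cat B' e' c' s') (\<lambda>n. n) (\<lambda>m n. lin_ext (\<phi> m n))"
      by (rule star_functor_lin_ext)
    show "star_functor (lin_cat B' e' c' s') (lin_cat B e c s) (\<lambda>n. n) (\<lambda>m n. lin_ext (\<psi> m n))"
      by (rule I.star_functor_lin_ext)
    show "unitary_nat_iso (lin_cat B e c s) (lin_cat B e c s) (\<lambda>a. a) (\<lambda>a b f. f)
        (\<lambda>a. a) (\<lambda>a b f. lin_ext (\<psi> a b) (lin_ext (\<phi> a b) f))
        (\<lambda>n. Poly_Mapping.single (e n) 1)"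
      by (rule unitary_nat_iso_lin_cat_id) (simp add: lin_ext_inv_map)
    show "unitary_nat_iso (lin_cat B' e' c' s') (lin_cat B' e' c' s')
        (\<lambda>a. a) (\<lambda>a b f. lin_ext (\<phi> a b) (lin_ext (\<psi> a b) f)) (\<lambda>a. a) (\<lambda>a b f. f)
        (\<lambda>n. Poly_Mapping.single (e' n) 1)"
      by (rule I.unitary_nat_iso_lin_cat_id) (simp add: lin_ext_map_inv)
  qed
qed

end

lemma basis_star_iso_comp:
  assumes "basis_star_iso B e c s B' e' c' s' \<phi>" "basis_star_iso B' e' c' s' B'' e'' c'' s'' \<chi>"
  shows "basis_star_iso B e c s B'' e'' c'' s'' (\<lambda>m n. \<chi> m n \<circ> \<phi> m n)"
proof -
  interpret F: basis_star_iso B e c s B' e' c' s' \<phi> by fact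
  interpret G: basis_star_iso B' e' c' s' B'' e'' c'' s'' \<chi> by fact
  show ?thesis
    by unfold_locales
      (auto simp: F.map_id G.map_id F.map_comp G.map_comp F.map_star G.map_star F.map_in
        intro: bij_betw_trans F.bij G.bij)
qed

section \<open>Order-preserving partial injections and rook diagrams\<close>

text \<open>The single equivalence packs three properties: applied to two pairs in both orders it
  also yields \<open>a = a' \<longleftrightarrow> b = b'\<close>, that is, being a function and
  being injective. Its symmetry makes converses immediate.\<close>

definition pinj :: "nat \<Rightarrow> nat \<Rightarrow> (nat \<times> nat) set \<Rightarrow> bool"
  where "pinj m n R \<longleftrightarrow> R \<subseteq> {1..m} \<times> {1..n} \<and>
    (\<forall>(a, b)\<in>R. \<forall>(a', b')\<in>R. a < a' \<longleftrightarrow> b < b')"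

lemma pinj_less_iff: "\<lbrakk>pinj m n R; (a, b) \<in> R; (a', b') \<in> R\<rbrakk> \<Longrightarrow> a < a' \<longleftrightarrow> b < b'"
  unfolding pinj_def by blast

lemma pinj_eq_iff: "\<lbrakk>pinj m n R; (a, b) \<in> R; (a', b') \<in> R\<rbrakk> \<Longrightarrow> a = a' \<longleftrightarrow> b = b'"
  using pinj_less_iff[of m n R a b a' b'] pinj_less_iff[of m n R a' b' a b] by linarith

lemma pinj_bounds: "\<lbrakk>pinj m n R; (a, b) \<in> R\<rbrakk> \<Longrightarrow> 1 \<le> a \<and> a \<le> m \<and> 1 \<le> b \<and> b \<le> n"
  unfolding pinj_def by auto

lemma pinj_Id: "pinj n n (Id_on {1..n})"
  by (auto simp: pinj_def)

lemma pinj_converse: "pinj m n R \<Longrightarrow> pinj n m (R\<inverse>)"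
  unfolding pinj_def by fast

lemma pinj_relcomp:
  assumes "pinj m n R" "pinj n p S"
  shows "pinj m p (R O S)"
proof -
  have "a < a' \<longleftrightarrow> b < b'" if "(a, b) \<in> R O S" "(a', b') \<in> R O S" for a b a' b'
    using that pinj_less_iff[OF assms(1)] pinj_less_iff[OF assms(2)] by blast
  moreover have "R O S \<subseteq> {1..m} \<times> {1..p}"
    using assms unfolding pinj_def by blast
  ultimately show ?thesis unfolding pinj_def by blast
qed

text \<open>The string through a given marked point. The \<open>Mid\<close> value is a filler that
  keeps every point inside its own block.\<close>

primrec block :: "(nat \<times> nat) set \<Rightarrow> point \<Rightarrow> point set" where
  "block R (Bot i) = insert (Bot i) (Top ` (R `` {i}))"
| "block R (Mid i) = {Mid i}"
| "block R (Top j) = insert (Top j) (Bot ` (R\<inverse> `` {j}))"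

definition points :: "nat \<Rightarrow> nat \<Rightarrow> point set"
  where "points m n = Bot ` {1..m} \<union> Top ` {1..n}"

definition diagram :: "nat \<Rightarrow> nat \<Rightarrow> (nat \<times> nat) set \<Rightarrow> point set set"
  where "diagram m n R = block R ` points m n"

definition strings_rel :: "point set set \<Rightarrow> (nat \<times> nat) set"
  where "strings_rel D = {(i, j). \<exists>s\<in>D. Bot i \<in> s \<and> Top j \<in> s}"

lemma in_points [simp]:
  "Bot i \<in> points m n \<longleftrightarrow> 1 \<le> i \<and> i \<le> m"
  "Mid i \<notin> points m n"
  "Top j \<in> points m n \<longleftrightarrow> 1 \<le> j \<and> j \<le> n"
  by (auto simp: points_def)

lemma block_self: "x \<in> block R x"
  by (cases x) auto

lemma block_subset_points: "\<lbrakk>pinj m n R; x \<in> points m n\<rbrakk> \<Longrightarrow> block R x \<subseteq> points m n"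
  by (cases x) (auto dest: pinj_bounds)

lemma block_eq: "\<lbrakk>pinj m n R; y \<in> block R x\<rbrakk> \<Longrightarrow> block R y = block R x"
  by (cases x; cases y) (auto dest: pinj_eq_iff)

lemma Bot_block: "Bot i \<in> block R x \<longleftrightarrow> x = Bot i \<or> (\<exists>j. x = Top j \<and> (i, j) \<in> R)"
  by (cases x) auto

lemma Top_block: "Top j \<in> block R x \<longleftrightarrow> x = Top j \<or> (\<exists>i. x = Bot i \<and> (i, j) \<in> R)"
  by (cases x) auto

lemma card_block:
  assumes "pinj m n R"
  shows "card (block R x) = 1 \<or> card (block R x) = 2"
proof (cases x)
  case (Bot i)
  show ?thesis
  proof (cases "\<exists>j. (i, j) \<in> R")
    case True
    then obtain j where "(i, j) \<in> R" by blast
    with assms have "R `` {i} = {j}" by (auto dest: pinj_eq_iff)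
    then show ?thesis using Bot by simp
  next
    case False
    then have "R `` {i} = {}" by auto
    then show ?thesis using Bot by simp
  qed
next
  case (Top j)
  show ?thesis
  proof (cases "\<exists>i. (i, j) \<in> R")
    case True
    then obtain i where "(i, j) \<in> R" by blast
    with assms have "R\<inverse> `` {j} = {i}" by (auto dest: pinj_eq_iff)
    then show ?thesis using Top by simp
  next
    case False
    then have "R\<inverse> `` {j} = {}" by auto
    then show ?thesis using Top by simp
  qed
qed simp

lemma rook_diagram_diagram:
  assumes R: "pinj m n R"
  shows "rook_diagram m n (diagram m n R)"
  unfolding rook_diagram_def points_def[symmetric]
proof (intro conjI ballI allI impI)
  show "partition_on (points m n) (diagram m n R)"
  proof (rule partition_onI)
    show "\<Union> (diagram m n R) = points m n"
      using block_self block_subset_points[OF R] by (auto simp: diagram_def)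
    show "disjnt s t" if "s \<in> diagram m n R" "t \<in> diagram m n R" "s \<noteq> t" for s t
      using that block_eq[OF R] unfolding diagram_def disjnt_iff by (metis imageE)
    show "{} \<notin> diagram m n R"
      using block_self by (fastforce simp: diagram_def)
  qed
next
  fix s assume s: "s \<in> diagram m n R"
  show "card s = 1 \<or> card s = 2"
    using s card_block[OF R] by (auto simp: diagram_def)
  show "i = i'" if "Bot i \<in> s \<and> Bot i' \<in> s" for i i'
    using s that by (auto simp: diagram_def Bot_block dest: pinj_eq_iff[OF R])
  show "j = j'" if "Top j \<in> s \<and> Top j' \<in> s" for j j'
    using s that by (auto simp: diagram_def Top_block dest: pinj_eq_iff[OF R])
  fix t i j i' j'
  assume t: "t \<in> diagram m n R" and
    *: "Bot i \<in> s \<and> Top j \<in> s \<and> Bot i' \<in> t \<and> Top j' \<in> t \<and> i < i'"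
  have "(i, j) \<in> R" "(i', j') \<in> R"
    using s t * by (auto simp: diagram_def Bot_block Top_block)
  then show "j < j'" using * pinj_less_iff[OF R] by blast
qed

lemma strings_rel_diagram: "pinj m n R \<Longrightarrow> strings_rel (diagram m n R) = R"
proof (intro set_eqI iffI; clarify)
  fix a b assume R: "pinj m n R"
  show "(a, b) \<in> R" if "(a, b) \<in> strings_rel (diagram m n R)"
    using that by (auto simp: strings_rel_def diagram_def Bot_block Top_block)
  assume ab: "(a, b) \<in> R"
  with pinj_bounds[OF R ab] have "block R (Bot a) \<in> diagram m n R"
    "Bot a \<in> block R (Bot a)" "Top b \<in> block R (Bot a)"
    by (auto simp: diagram_def simp del: block.simps) (auto simp: Bot_block Top_block)
  then show "(a, b) \<in> strings_rel (diagram m n R)"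
    unfolding strings_rel_def by blast
qed

text \<open>A string is either a single point or a bottom-top pair, so the relation of through
  strings loses nothing: unmatched points must form strings of their own.\<close>

lemma rook_diagram_cases:
  assumes "rook_diagram m n D"
  obtains R where "pinj m n R" "D = diagram m n R"
proof
  let ?R = "strings_rel D"
  have part: "partition_on (points m n) D"
    and bot: "\<And>s i i'. s \<in> D \<Longrightarrow> Bot i \<in> s \<Longrightarrow> Bot i' \<in> s \<Longrightarrow> i = i'"
    and top: "\<And>s j j'. s \<in> D \<Longrightarrow> Top j \<in> s \<Longrightarrow> Top j' \<in> s \<Longrightarrow> j = j'"
    and cross: "\<And>s s' i j i' j'. s \<in> D \<Longrightarrow> s' \<in> D \<Longrightarrow> Bot i \<in> s \<Longrightarrow> Top j \<in> s \<Longrightarrow>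
        Bot i' \<in> s' \<Longrightarrow> Top j' \<in> s' \<Longrightarrow> i < i' \<Longrightarrow> j < j'"
    using assms unfolding rook_diagram_def points_def by metis+
  have union: "\<Union>D = points m n" and ne: "{} \<notin> D"
    using part by (auto simp: partition_on_def)
  have same: "s = t" if "s \<in> D" "t \<in> D" "x \<in> s" "x \<in> t" for s t x
  proof (rule ccontr)
    assume "s \<noteq> t"
    with disjointD[OF partition_onD2[OF part] that(1,2)] that(3,4) show False by blast
  qed
  show "pinj m n ?R"
    unfolding pinj_def
  proof (intro conjI)
    show "?R \<subseteq> {1..m} \<times> {1..n}"
    proof (clarsimp simp: strings_rel_def)
      fix a b s assume "s \<in> D" "Bot a \<in> s" "Top b \<in> s"
      then have "Bot a \<in> points m n" "Top b \<in> points m n" using union by blast+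
      then show "Suc 0 \<le> a \<and> a \<le> m \<and> Suc 0 \<le> b \<and> b \<le> n" by simp
    qed
    \<comment> \<open>Non-crossing gives only one implication. The converse comes from trichotomy on
      \<open>a\<close> and \<open>a'\<close>, where equality forces both pairs onto one
      string.\<close>
    have "a < a' \<longleftrightarrow> b < b'" if ab: "(a, b) \<in> ?R" "(a', b') \<in> ?R" for a b a' b'
    proof -
      obtain s s' where s: "s \<in> D" "Bot a \<in> s" "Top b \<in> s" "s' \<in> D" "Bot a' \<in> s'" "Top b' \<in> s'"
        using ab by (auto simp: strings_rel_def)
      have "b = b'" if "a = a'"
      proof -
        have "s = s'" using same[OF s(1,4,2)] s(5) that by simp
        then show ?thesis using top[OF s(1,3)] s(6) by simp
      qed
      moreover have "b < b'" if "a < a'" using cross[OF s(1,4,2,3,5,6) that] .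
      moreover have "b' < b" if "a' < a" using cross[OF s(4,1,5,6,2,3) that] .
      ultimately show ?thesis by (cases a a' rule: linorder_cases) auto
    qed
    then show "\<forall>(a, b)\<in>?R. \<forall>(a', b')\<in>?R. a < a' \<longleftrightarrow> b < b'" by blast
  qed
  \<comment> \<open>Any one point determines its string: two points of a string on the same side
    coincide, and points on opposite sides are related by \<open>?R\<close>.\<close>
  have blk: "s = block ?R x" if "s \<in> D" "x \<in> s" for s x
  proof -
    have "x \<in> points m n" using that union by blast
    have "y \<in> block ?R x" if "y \<in> s" for y
    proof -
      have "y \<in> points m n" using that \<open>s \<in> D\<close> union by blast
      with \<open>x \<in> points m n\<close> show ?thesis
        using that \<open>s \<in> D\<close> \<open>x \<in> s\<close>
        by (cases x; cases y) (auto simp: strings_rel_def dest: bot top)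
    qed
    moreover have "y \<in> s" if "y \<in> block ?R x" for y
      using \<open>x \<in> points m n\<close> that \<open>x \<in> s\<close>
      by (cases x; cases y) (auto simp: strings_rel_def dest: same[OF \<open>s \<in> D\<close>])
    ultimately show ?thesis by blast
  qed
  show "D = diagram m n ?R"
  proof
    show "D \<subseteq> diagram m n ?R"
    proof
      fix s assume "s \<in> D"
      then obtain x where "x \<in> s" using ne by (metis ex_in_conv)
      then show "s \<in> diagram m n ?R"
        using blk[OF \<open>s \<in> D\<close> \<open>x \<in> s\<close>] \<open>s \<in> D\<close> union by (auto simp: diagram_def)
    qed
    show "diagram m n ?R \<subseteq> D"
      unfolding diagram_def using blk union by (metis (no_types, lifting) UnionE image_subsetI)
  qed
qed

lemma bij_betw_diagram: "bij_betw (diagram m n) {R. pinj m n R} {D. rook_diagram m n D}"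
  by (rule bij_betw_byWitness[where f' = strings_rel])
    (auto simp: strings_rel_diagram rook_diagram_diagram elim!: rook_diagram_cases)

lemma diagram_Id: "diagram n n (Id_on {1..n}) = id_diagram n"
proof -
  have "block (Id_on {1..n}) (Bot i) = {Bot i, Top i}"
    "block (Id_on {1..n}) (Top i) = {Bot i, Top i}" if "i \<in> {1..n}" for i
    using that by auto
  then show ?thesis
    by (auto simp: diagram_def points_def id_diagram_def image_Un image_image
        simp del: block.simps)
qed

lemma diagram_converse: "diagram n m (R\<inverse>) = reflect (diagram m n R)"
proof -
  have flip: "flip_point ` block R x = block (R\<inverse>) (flip_point x)" for x
    by (cases x) (auto simp: image_image)
  have "points n m = flip_point ` points m n"
    by (auto simp: points_def image_Un image_image)
  then show ?thesis
    by (simp add: diagram_def reflect_def image_image flip)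
qed

text \<open>A closed formula for the connected component of a point in the glued picture of
  \<open>R\<close> below and \<open>S\<close> above; it replaces reasoning about the transitive
  closure in \<open>stack\<close>.\<close>

primrec component :: "(nat \<times> nat) set \<Rightarrow> (nat \<times> nat) set \<Rightarrow> point \<Rightarrow> point set" where
  "component R S (Bot i) = insert (Bot i) (Mid ` (R `` {i}) \<union> Top ` ((R O S) `` {i}))"
| "component R S (Mid j) = insert (Mid j) (Bot ` (R\<inverse> `` {j}) \<union> Top ` (S `` {j}))"
| "component R S (Top k) = insert (Top k) (Mid ` (S\<inverse> `` {k}) \<union> Bot ` ((R O S)\<inverse> `` {k}))"

lemma diagram_relcomp:
  assumes R: "pinj m n R" and S: "pinj n p S"
  shows "diagram m p (R O S) = stack (diagram n p S) (diagram m n R)"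
proof -
  define T where "T = (`) top_to_mid ` diagram m n R \<union> (`) bot_to_mid ` diagram n p S"
  define E where "E = on_common_string T"
  have E_lower: "(top_to_mid x, top_to_mid y) \<in> E" if "x \<in> points m n" "y \<in> block R x" for x y
  proof -
    have "top_to_mid ` block R x \<in> T" using that(1) by (simp add: T_def diagram_def)
    then show ?thesis
      unfolding E_def on_common_string_def using that(2) block_self[of x R] by blast
  qed
  have E_upper: "(bot_to_mid x, bot_to_mid y) \<in> E" if "x \<in> points n p" "y \<in> block S x" for x y
  proof -
    have "bot_to_mid ` block S x \<in> T" using that(1) by (simp add: T_def diagram_def)
    then show ?thesis
      unfolding E_def on_common_string_def using that(2) block_self[of x S] by blast
  qed
  have lower: "component R S (top_to_mid y) = component R S (top_to_mid x)" if "y \<in> block R x" for x y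
    using that by (cases x; cases y) (auto dest: pinj_eq_iff[OF R] pinj_eq_iff[OF S])
  have upper: "component R S (bot_to_mid y) = component R S (bot_to_mid x)" if "y \<in> block S x" for x y
    using that by (cases x; cases y) (auto dest: pinj_eq_iff[OF R] pinj_eq_iff[OF S])
  have edge: "component R S x = component R S y" if "(x, y) \<in> E" for x y
  proof -
    from that consider z where "x \<in> top_to_mid ` block R z" "y \<in> top_to_mid ` block R z"
      | z where "x \<in> bot_to_mid ` block S z" "y \<in> bot_to_mid ` block S z"
      unfolding E_def on_common_string_def T_def diagram_def by blast
    then show ?thesis using lower upper by cases (metis imageE)+
  qed
  \<comment> \<open>Constancy along edges bounds the closure from above: whatever is reached from
    \<open>x\<close> lies in its own component, hence in that of \<open>x\<close>.\<close>
  have inv: "component R S x = component R S y" if "(x, y) \<in> E\<^sup>*" for x y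
    using that by (induction rule: rtrancl_induct) (auto dest: edge)
  have self: "x \<in> component R S x" for x
    by (cases x) auto
  have RE: "(Bot i, Mid j) \<in> E" "(Mid j, Bot i) \<in> E" if "(i, j) \<in> R" for i j
    using E_lower[of "Bot i" "Top j"] E_lower[of "Top j" "Bot i"] that pinj_bounds[OF R that]
    by (auto simp: points_def)
  have SE: "(Mid j, Top k) \<in> E" "(Top k, Mid j) \<in> E" if "(j, k) \<in> S" for j k
    using E_upper[of "Bot j" "Top k"] E_upper[of "Top k" "Bot j"] that pinj_bounds[OF S that]
    by (auto simp: points_def)
  \<comment> \<open>Two edges suffice, since a through string crosses the middle line only
    once.\<close>
  have reach: "(x, y) \<in> E\<^sup>*" if "y \<in> component R S x" for x y
    using that by (cases x) (auto intro: RE SE converse_rtrancl_into_rtrancl[OF _ r_into_rtrancl])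
  have "E\<^sup>* `` {x} = component R S x" for x
    using inv reach self by blast
  moreover have "component R S x - range Mid = block (R O S) x" if "x \<in> points m p" for x
    using that by (auto simp: points_def)
  moreover have "\<Union>T - range Mid = points m p"
  proof -
    have "\<Union>(diagram m n R) = points m n" "\<Union>(diagram n p S) = points n p"
      using rook_diagram_diagram[OF R] rook_diagram_diagram[OF S]
      by (auto simp: rook_diagram_def partition_on_def points_def)
    moreover have "\<Union>T = top_to_mid ` \<Union>(diagram m n R) \<union> bot_to_mid ` \<Union>(diagram n p S)"
      unfolding T_def by (simp add: image_Union)
    ultimately have "\<Union>T = Bot ` {1..m} \<union> Mid ` {1..n} \<union> Top ` {1..p}"
      by (simp add: points_def image_Un image_image Un_ac)
    then show ?thesis by (auto simp: points_def)
  qed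
  ultimately show ?thesis
    unfolding stack_def Let_def T_def[symmetric] E_def[symmetric] by (simp add: diagram_def)
qed

section \<open>Words as partial injections\<close>

text \<open>The coface map of the simplex category: the increasing injection whose image misses
  exactly \<open>i\<close>. AG1 is the cosimplicial identity for these maps.\<close>

definition skip :: "nat \<Rightarrow> nat \<Rightarrow> nat"
  where "skip i k = (if k < i then k else Suc k)"

lemma skip_less_iff [simp]: "skip i a < skip i b \<longleftrightarrow> a < b"
  by (auto simp: skip_def)

lemma skip_bounds: "a \<le> skip i a" "skip i a \<le> Suc a"
  by (auto simp: skip_def)

text \<open>The square with \<open>skip j\<close>, \<open>skip i\<close> and the legs
  \<open>skip i\<close>, \<open>skip (j - 1)\<close> is a pullback: a point in both images avoids
  \<open>i\<close> and \<open>j\<close>, so it comes from a set with two points fewer. This base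
  change property is what AG2 expresses for unequal indices.\<close>

lemma skip_pullback:
  assumes "1 \<le> i" "i < j" "j \<le> Suc m"
  shows "(\<exists>y. 1 \<le> y \<and> y \<le> m - 1 \<and> x = skip i y \<and> z = skip (j - 1) y) \<longleftrightarrow>
    1 \<le> x \<and> x \<le> m \<and> 1 \<le> z \<and> z \<le> m \<and> skip j x = skip i z"
proof
  assume "\<exists>y. 1 \<le> y \<and> y \<le> m - 1 \<and> x = skip i y \<and> z = skip (j - 1) y"
  then show "1 \<le> x \<and> x \<le> m \<and> 1 \<le> z \<and> z \<le> m \<and> skip j x = skip i z"
    using assms by (auto simp: skip_def split: if_splits)
next
  assume "1 \<le> x \<and> x \<le> m \<and> 1 \<le> z \<and> z \<le> m \<and> skip j x = skip i z"
  then show "\<exists>y. 1 \<le> y \<and> y \<le> m - 1 \<and> x = skip i y \<and> z = skip (j - 1) y"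
    \<comment> \<open>The witness inverts \<open>skip i\<close> at \<open>x\<close>. The value
      \<open>x = i\<close> cannot occur: \<open>skip j\<close> would fix it, whereas
      \<open>skip i\<close> misses it.\<close>
    using assms by (intro exI[of _ "if x < i then x else x - 1"]) (auto simp: skip_def split: if_splits)
qed

fun letter_tgt :: "nat \<Rightarrow> letter \<Rightarrow> nat" where
  "letter_tgt n (Alpha i) = Suc n"
| "letter_tgt n (AlphaStar i) = n - 1"
| "letter_tgt n Tau = n"
| "letter_tgt n TauStar = n"

text \<open>With points numbered from 1, \<open>a mod n + 1\<close> is the cyclic successor. For
  \<open>n = 0\<close> the interval is empty, so the modulus zero is harmless. Starred letters
  receive the converse relations.\<close>

fun letter_rel :: "nat \<Rightarrow> letter \<Rightarrow> (nat \<times> nat) set" where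
  "letter_rel n (Alpha i) = {(a, b). a \<in> {1..n} \<and> b = skip i a}"
| "letter_rel n (AlphaStar i) = {(a, b). b \<in> {1..n - 1} \<and> a = skip i b}"
| "letter_rel n Tau = {(a, b). a \<in> {1..n} \<and> b = a mod n + 1}"
| "letter_rel n TauStar = {(a, b). b \<in> {1..n} \<and> a = b mod n + 1}"

primrec tgt :: "nat \<Rightarrow> letter list \<Rightarrow> nat" where
  "tgt m [] = m"
| "tgt m (l # w) = letter_tgt (tgt m w) l"

primrec word_rel :: "nat \<Rightarrow> letter list \<Rightarrow> (nat \<times> nat) set" where
  "word_rel m [] = Id_on {1..m}"
| "word_rel m (l # w) = word_rel m w O letter_rel (tgt m w) l"

lemma ag_word_simps [simp]:
  "ag_word m n [] \<longleftrightarrow> m = n"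
  "ag_word m n (Alpha i # w) \<longleftrightarrow> (\<exists>n'. n = Suc n' \<and> 1 \<le> i \<and> i \<le> n \<and> ag_word m n' w)"
  "ag_word m n (AlphaStar i # w) \<longleftrightarrow> 1 \<le> i \<and> i \<le> Suc n \<and> ag_word m (Suc n) w"
  "ag_word m n (Tau # w) \<longleftrightarrow> ag_word m n w"
  "ag_word m n (TauStar # w) \<longleftrightarrow> ag_word m n w"
  by (subst ag_word.simps; auto)+

lemma tgt_append [simp]: "tgt m (u @ v) = tgt (tgt m v) u"
  by (induction u) auto

lemma ag_word_tgt: "ag_word m n w \<Longrightarrow> tgt m w = n"
  by (induction rule: ag_word.induct) auto

lemma ag_word_append: "ag_word m p (u @ v) \<longleftrightarrow> (\<exists>n. ag_word m n v \<and> ag_word n p u)"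
proof (induction u arbitrary: p)
  case (Cons l u)
  then show ?case by (cases l) auto
qed (auto dest: ag_word_tgt)

lemma ag_word_Cons_iff: "ag_word m n (l # w) \<longleftrightarrow> (\<exists>k. ag_word m k w \<and> ag_word k n [l])"
  using ag_word_append[of m n "[l]" w] by simp

lemma ag_word_appendI: "\<lbrakk>ag_word m n v; ag_word n p u\<rbrakk> \<Longrightarrow> ag_word m p (u @ v)"
  by (auto simp: ag_word_append)

lemma ag_word_word_adj: "ag_word m n w \<Longrightarrow> ag_word n m (word_adj w)"
  by (induction rule: ag_word.induct) (auto simp: word_adj_def ag_word_append)

lemma word_adj_simps [simp]:
  "word_adj [] = []"
  "word_adj (u @ v) = word_adj v @ word_adj u"
  by (simp_all add: word_adj_def)

lemma letter_adj_adj [simp]: "letter_adj (letter_adj l) = l"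
  by (cases l) auto

lemma word_adj_adj [simp]: "word_adj (word_adj w) = w"
  by (simp add: word_adj_def rev_map map_idI)

lemma letter_rel_subset: "letter_rel n l \<subseteq> {1..n} \<times> {1..letter_tgt n l}"
  by (cases l) (auto simp: skip_def Suc_le_eq)

lemma word_rel_subset: "word_rel m w \<subseteq> {1..m} \<times> {1..tgt m w}"
proof (induction w)
  case (Cons l w)
  then show ?case using letter_rel_subset[of "tgt m w" l] by auto
qed auto

lemma word_rel_append: "word_rel m (u @ v) = word_rel m v O word_rel (tgt m v) u"
proof (induction u)
  case Nil
  show ?case using word_rel_subset[of m v] by auto
qed auto

lemma word_rel_single: "word_rel n [l] = letter_rel n l"
  using letter_rel_subset[of n l] by auto

lemma word_rel_pair: "word_rel n [l, l'] = letter_rel n l' O letter_rel (letter_tgt n l') l"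
  using word_rel_append[of n "[l]" "[l']"] by (simp only: word_rel_single tgt.simps append.simps)

lemma letter_rel_adj: "ag_word k n [l] \<Longrightarrow> letter_rel n (letter_adj l) = (letter_rel k l)\<inverse>"
  by (cases l) auto

lemma word_rel_word_adj: "ag_word m n w \<Longrightarrow> word_rel n (word_adj w) = (word_rel m w)\<inverse>"
proof (induction w arbitrary: n)
  case (Cons l w)
  then obtain k where k: "ag_word m k w" "ag_word k n [l]"
    by (subst (asm) ag_word_Cons_iff) blast
  then have "tgt n [letter_adj l] = k"
    using ag_word_tgt[OF ag_word_word_adj[OF k(2)]] by (simp add: word_adj_def)
  moreover have "word_adj (l # w) = word_adj w @ [letter_adj l]" by (simp add: word_adj_def)
  ultimately have "word_rel n (word_adj (l # w)) =
      word_rel n [letter_adj l] O word_rel k (word_adj w)"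
    by (simp only: word_rel_append)
  also have "\<dots> = (letter_rel k l)\<inverse> O (word_rel m w)\<inverse>"
    by (simp only: word_rel_single Cons.IH[OF k(1)] letter_rel_adj[OF k(2)])
  finally show ?case
    by (simp add: ag_word_tgt[OF k(1)] converse_relcomp)
qed auto

lemma word_rel_replicate_Tau:
  "word_rel n (replicate k Tau) = {(a, b). a \<in> {1..n} \<and> b = (a - 1 + k) mod n + 1}"
proof (induction k)
  case 0
  show ?case by auto
next
  case (Suc k)
  have "tgt n (replicate k Tau) = n" by (induction k) auto
  moreover have "((a - 1 + k) mod n + 1) mod n = (a - 1 + Suc k) mod n" for a
    by (simp add: mod_Suc_eq)
  moreover have "(a - 1 + k) mod n + 1 \<le> n" if "a \<in> {1..n}" for a
    using that by (simp add: Suc_le_eq)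
  ultimately show ?case
    using Suc by (auto simp: relcomp_unfold)
qed

lemma mod_cyclic: "\<lbrakk>Suc 0 \<le> a; a \<le> m\<rbrakk> \<Longrightarrow> a mod m = (if a = m then 0 else a)"
  by auto

text \<open>This is AG4 on points. The wrap-around \<open>a = k\<close> is the delicate case: both
  sides equal 1, because \<open>i \<ge> 2\<close> leaves 1 fixed and \<open>skip (i - 1)\<close>
  sends \<open>k\<close> to the last point.\<close>

lemma skip_rotate:
  assumes "2 \<le> i" "i \<le> Suc k" "1 \<le> a" "a \<le> k"
  shows "skip i (a mod k + 1) = skip (i - 1) a mod Suc k + 1"
  using assms by (cases "a = k") (auto simp: skip_def)

section \<open>Soundness of the relations for the action\<close>

lemma ag_rel_sound:
  assumes "ag_rel m n u v"
  shows "ag_word m n u \<and> ag_word m n v \<and> word_rel m u = word_rel m v"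
  using assms
proof cases
  case (AG3_order)
  have "ag_word m m (replicate k Tau)" for k by (induction k) auto
  then show ?thesis using AG3_order by (auto simp: word_rel_replicate_Tau)
next
  case (AG2_less i j)
  moreover from this obtain k where "m = Suc k" by (cases m) auto
  ultimately show ?thesis using skip_pullback[of i j m]
    by (auto simp: word_rel_pair relcomp_unfold simp del: word_rel.simps)
next
  case (AG2_greater j i)
  moreover from this obtain k where "m = Suc k" by (cases m) auto
  \<comment> \<open>The pullback square is used transposed here: the smaller index now belongs to
    \<open>Alpha\<close>, so \<open>x\<close> and \<open>z\<close> exchange roles.\<close>
  moreover from AG2_greater have "word_rel m v =
      {(x, z). \<exists>y. 1 \<le> y \<and> y \<le> m - 1 \<and> z = skip j y \<and> x = skip (i - 1) y}"
    by (auto simp: word_rel_pair simp del: word_rel.simps)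
  ultimately show ?thesis using skip_pullback[of j i m]
    by (auto simp: word_rel_pair relcomp_unfold simp del: word_rel.simps)
next
  case (AG1 i j)
  then show ?thesis
    by (auto simp: word_rel_pair relcomp_unfold skip_def simp del: word_rel.simps(2) split: if_splits)
next
  case (AG1_star i j)
  then show ?thesis
    by (auto simp: word_rel_pair relcomp_unfold skip_def simp del: word_rel.simps(2) split: if_splits)
next
  case (AG2_eq i)
  then show ?thesis
    by (auto simp: word_rel_pair relcomp_unfold skip_def simp del: word_rel.simps(2) split: if_splits)
next
  case AG3_inv_left
  then show ?thesis
    by (auto simp: word_rel_pair relcomp_unfold mod_cyclic simp del: word_rel.simps(2) split: if_splits)
next
  case AG3_inv_right
  have "\<exists>y. 1 \<le> y \<and> y \<le> m \<and> a = y mod m + 1" if "1 \<le> a" "a \<le> m" for a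
    \<comment> \<open>The witness is the cyclic predecessor of \<open>a\<close>.\<close>
    using that by (intro exI[of _ "if a = 1 then m else a - 1"]) auto
  moreover have "y mod m + 1 \<le> m" if "1 \<le> y" "y \<le> m" for y
    using that by (simp add: Suc_le_eq)
  ultimately have "letter_rel m TauStar O letter_rel m Tau = Id_on {1..m}"
    by fastforce
  with AG3_inv_right show ?thesis by (simp add: word_rel_pair del: word_rel.simps(2) letter_rel.simps)
next
  case AG3_zero
  then show ?thesis by auto
next
  case (AG4 i)
  then obtain k where k: "n = Suc k" "m = k" by (cases n) auto
  have "{(x, z). x \<in> {1..k} \<and> z = skip i (x mod k + 1)} =
      {(x, z). x \<in> {1..k} \<and> z = skip (i - 1) x mod Suc k + 1}"
    using skip_rotate[of i k] AG4 k by auto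
  moreover have "word_rel m u = {(x, z). x \<in> {1..k} \<and> z = skip i (x mod k + 1)}"
    using AG4 k by (auto simp: word_rel_pair Suc_le_eq simp del: word_rel.simps(2))
  moreover have "word_rel m v = {(x, z). x \<in> {1..k} \<and> z = skip (i - 1) x mod Suc k + 1}"
    using AG4 k skip_bounds[of _ "i - 1"]
    by (auto simp: word_rel_pair relcomp_unfold simp del: word_rel.simps(2)
        intro: order_trans[OF _ skip_bounds(1)] order_trans[OF skip_bounds(2)])
  ultimately show ?thesis using AG4 k by auto
next
  case (AG4_star i)
  then obtain k where k: "m = Suc k" "n = k" by (cases m) auto
  have rot: "x \<in> {1..Suc k} \<and> z \<in> {1..k} \<and> x mod Suc k + 1 = skip i z \<longleftrightarrow>
    (\<exists>y\<in>{1..k}. x = skip (i - 1) y \<and> z = y mod k + 1)" for x z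
  proof
    assume "x \<in> {1..Suc k} \<and> z \<in> {1..k} \<and> x mod Suc k + 1 = skip i z"
    then have x: "x \<in> {1..Suc k}" and z: "z \<in> {1..k}" and xz: "x mod Suc k + 1 = skip i z"
      by auto
    \<comment> \<open>The cyclic predecessor of \<open>z\<close> in \<open>{1..k}\<close>.
      Cancelling the rotation of \<open>Suc k\<close> points then recovers \<open>x\<close> from
      \<open>skip_rotate\<close>.\<close>
    define y where "y = (if z = 1 then k else z - 1)"
    have y: "1 \<le> y" "y \<le> k" "z = y mod k + 1"
      using z by (auto simp: y_def mod_cyclic)
    have "x mod Suc k = skip (i - 1) y mod Suc k"
      using skip_rotate[of i k y] AG4_star k y xz by simp
    moreover have "1 \<le> skip (i - 1) y" "skip (i - 1) y \<le> Suc k"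
      using y skip_bounds[of y "i - 1"] skip_bounds(2)[of "i - 1" y] by linarith+
    ultimately have "x = skip (i - 1) y"
      using x by (auto simp: mod_cyclic split: if_splits)
    then show "\<exists>y\<in>{1..k}. x = skip (i - 1) y \<and> z = y mod k + 1" using y by auto
  next
    assume "\<exists>y\<in>{1..k}. x = skip (i - 1) y \<and> z = y mod k + 1"
    then obtain y where y: "1 \<le> y" "y \<le> k" "x = skip (i - 1) y" "z = y mod k + 1" by auto
    then have "x \<le> Suc k" "1 \<le> x"
      using skip_bounds[of y "i - 1"] skip_bounds(2)[of "i - 1" y] by linarith+
    then show "x \<in> {1..Suc k} \<and> z \<in> {1..k} \<and> x mod Suc k + 1 = skip i z"
      using skip_rotate[of i k y] y AG4_star k by (auto simp: Suc_le_eq)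
  qed
  have "word_rel m u = {(x, z). x \<in> {1..Suc k} \<and> z \<in> {1..k} \<and> x mod Suc k + 1 = skip i z}"
    using AG4_star k by (auto simp: word_rel_pair relcomp_unfold simp del: word_rel.simps(2))
  also have "\<dots> = {(x, z). \<exists>y\<in>{1..k}. x = skip (i - 1) y \<and> z = y mod k + 1}"
    using rot by simp
  also have "\<dots> = word_rel m v"
    using AG4_star k by (auto simp: word_rel_pair relcomp_unfold simp del: word_rel.simps(2))
  finally show ?thesis using AG4_star k by auto
qed

text \<open>The only means of showing that two words differ in \<open>AG\<close>: it gives
  injectivity on classes, and it recovers typing from equality.\<close>

lemma ag_eq_sound:
  "ag_eq m n u v \<Longrightarrow> ag_word m n u \<and> ag_word m n v \<and> word_rel m u = word_rel m v"
proof (induction rule: ag_eq.induct)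
  case (rel m n u v)
  then show ?case by (rule ag_rel_sound)
next
  case (comp n p u u' m v v')
  then show ?case by (auto simp: word_rel_append ag_word_tgt intro: ag_word_appendI)
qed (auto simp: word_rel_word_adj ag_word_word_adj)

section \<open>Words without rotations\<close>

text \<open>Unlike standard forms, these words are closed under concatenation and adjoint, which
  makes them convenient representatives.\<close>

definition rect :: "letter list \<Rightarrow> bool"
  where "rect w \<longleftrightarrow> Tau \<notin> set w \<and> TauStar \<notin> set w"

lemma rect_simps [simp]:
  "rect []" "rect (Alpha i # w) = rect w" "rect (AlphaStar i # w) = rect w"
  "\<not> rect (Tau # w)" "\<not> rect (TauStar # w)"
  "rect (u @ v) \<longleftrightarrow> rect u \<and> rect v"
  "rect (map Alpha is)" "rect (map AlphaStar is)"
  by (auto simp: rect_def)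

lemma rect_word_adj [simp]: "rect (word_adj w) = rect w"
proof -
  have "rect (word_adj w)" if "rect w" for w
    using that
  proof (induction w)
    case (Cons l w)
    then show ?case by (cases l) (auto simp: word_adj_def)
  qed (simp add: word_adj_def)
  then show ?thesis by (metis word_adj_adj)
qed

lemma rect_Cons: "rect (l # w) \<longleftrightarrow> rect w \<and> (\<exists>i. l = Alpha i \<or> l = AlphaStar i)"
  by (cases l) auto

lemma pinj_word_rel: "\<lbrakk>rect w; ag_word m n w\<rbrakk> \<Longrightarrow> pinj m n (word_rel m w)"
proof (induction w arbitrary: n)
  case (Cons l w)
  then obtain k where k: "ag_word m k w" "ag_word k n [l]"
    by (subst (asm) (2) ag_word_Cons_iff) blast
  have "pinj k n (letter_rel k l)"
    using Cons.prems(1) k(2)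
    by (auto simp: rect_Cons pinj_def intro: order_trans[OF _ skip_bounds(1)] order_trans[OF skip_bounds(2)])
  moreover have "pinj m k (word_rel m w)"
    using Cons.IH[OF _ k(1)] Cons.prems(1) by (simp add: rect_Cons)
  ultimately show ?case
    using k(1) by (simp add: ag_word_tgt pinj_relcomp)
next
  case Nil
  then show ?case using pinj_Id[of n] by simp
qed

text \<open>Adding a through string on the right does not change the word.\<close>

lemma word_rel_Suc:
  assumes "rect w" "ag_word m n w"
  shows "ag_word (Suc m) (Suc n) w \<and> word_rel (Suc m) w = insert (Suc m, Suc n) (word_rel m w)"
  using assms
proof (induction w arbitrary: n)
  case Nil
  then show ?case by auto
next
  case (Cons l w)
  then obtain k where k: "ag_word m k w" "ag_word k n [l]" "rect w" "rect [l]"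
    using Cons.prems by (auto simp: rect_Cons ag_word_Cons_iff[of m n l w] simp del: ag_word_simps)
  have IH: "ag_word (Suc m) (Suc k) w" "word_rel (Suc m) w = insert (Suc m, Suc k) (word_rel m w)"
    using Cons.IH k by auto
  have "ag_word (Suc k) (Suc n) [l]"
    using k by (auto simp: rect_Cons)
  moreover have "letter_rel (Suc k) l = insert (Suc k, Suc n) (letter_rel k l)"
    using k by (auto simp: rect_Cons skip_def Suc_le_eq split: if_splits)
  moreover have "b \<le> k" if "(a, b) \<in> word_rel m w" for a b
    using that pinj_word_rel[OF k(3,1)] by (auto simp: pinj_def)
  moreover have "a \<le> k" if "(a, b) \<in> letter_rel k l" for a b
    using that letter_rel_subset[of k l] by auto
  ultimately show ?case
    using IH ag_word_appendI[of "Suc m" "Suc k" w "Suc n" "[l]"] k(1)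
    by (auto simp: ag_word_tgt relcomp_unfold) fastforce+
qed

text \<open>An unmatched last point is removed with one letter. If both last points are matched,
  monotonicity matches them to each other, and \<open>word_rel_Suc\<close> reuses the word found for
  the smaller relation.\<close>

lemma ex_rect_word:
  assumes "pinj m n R"
  obtains w where "rect w" "ag_word m n w" "word_rel m w = R"
proof -
  have "\<exists>w. rect w \<and> ag_word m n w \<and> word_rel m w = R"
    using assms
  proof (induction "m + n" arbitrary: m n R rule: less_induct)
    case less
    note R = \<open>pinj m n R\<close>
    consider "m = 0" "n = 0" | k where "n = Suc k" "n \<notin> Range R" | k where "m = Suc k" "m \<notin> Domain R"
      | k l where "m = Suc k" "n = Suc l" "m \<in> Domain R" "n \<in> Range R"
      by (metis DomainE RangeE not0_implies_Suc R pinj_bounds le_zero_eq zero_neq_one)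
    then show ?case
    proof cases
      case 1
      then have "R = {}" using R by (auto simp: pinj_def)
      then show ?thesis using 1 by (intro exI[of _ "[]"]) auto
    next
      case (2 k)
      have "b \<le> k" if "(a, b) \<in> R" for a b
        using pinj_bounds[OF R that] 2 that by (metis RangeI le_SucE)
      then have "pinj m k R" using R by (auto simp: pinj_def)
      with less(1)[of m k R] 2 obtain w where w: "rect w" "ag_word m k w" "word_rel m w = R"
        by auto
      \<comment> \<open>Inserting the last point leaves all others in place, so
        \<open>Alpha n\<close> acts as the inclusion of \<open>{1..k}\<close>. The next case uses
        its converse on the bottom side.\<close>
      have "(a, b) \<in> R O letter_rel k (Alpha n) \<longleftrightarrow> (a, b) \<in> R" for a b
        using pinj_bounds[OF \<open>pinj m k R\<close>] 2(1) by (force simp: skip_def relcomp_unfold)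
      then have "R O letter_rel k (Alpha n) = R" by auto
      then show ?thesis using w 2(1) by (intro exI[of _ "Alpha n # w"]) (auto simp: ag_word_tgt)
    next
      case (3 k)
      have "a \<le> k" if "(a, b) \<in> R" for a b
        using pinj_bounds[OF R that] 3 that by (metis DomainI le_SucE)
      then have "pinj k n R" using R by (auto simp: pinj_def)
      with less(1)[of k n R] 3 obtain w where w: "rect w" "ag_word k n w" "word_rel k w = R"
        by auto
      have "(a, b) \<in> letter_rel m (AlphaStar m) O R \<longleftrightarrow> (a, b) \<in> R" for a b
        using pinj_bounds[OF \<open>pinj k n R\<close>] 3(1) by (force simp: skip_def relcomp_unfold)
      then have "letter_rel m (AlphaStar m) O R = R" by auto
      then show ?thesis using w 3(1)
        by (intro exI[of _ "w @ [AlphaStar m]"])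
          (auto simp: ag_word_append word_rel_append word_rel_single simp del: word_rel.simps)
    next
      case (4 k l)
      then obtain x y where xy: "(m, y) \<in> R" "(x, n) \<in> R" by blast
      \<comment> \<open>If \<open>x < m\<close>, monotonicity would give \<open>n < y\<close>,
        beyond the last top point.\<close>
      have "x = m"
        using pinj_bounds[OF R] pinj_less_iff[OF R] xy by (metis leD le_neq_implies_less)
      with xy have mn: "(m, n) \<in> R" by simp
      define R' where "R' = R - {(m, n)}"
      have "1 \<le> a \<and> a \<le> k \<and> 1 \<le> b \<and> b \<le> l" if "(a, b) \<in> R'" for a b
        using that pinj_bounds[OF R, of a b] pinj_eq_iff[OF R _ mn, of a b] 4 by (auto simp: R'_def)
      then have "R' \<subseteq> {1..k} \<times> {1..l}" by auto
      moreover have "a < a' \<longleftrightarrow> b < b'" if "(a, b) \<in> R'" "(a', b') \<in> R'" for a b a' b'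
        using that pinj_less_iff[OF R] by (simp add: R'_def)
      ultimately have "pinj k l R'" unfolding pinj_def by blast
      with less(1)[of k l R'] 4 obtain w where w: "rect w" "ag_word k l w" "word_rel k w = R'"
        by auto
      have "R = insert (m, n) R'" using mn by (auto simp: R'_def)
      then show ?thesis using w word_rel_Suc[OF w(1,2)] 4 by (intro exI[of _ w]) auto
    qed
  qed
  then show thesis using that by blast
qed

section \<open>Standard forms\<close>

lemma ag_eq_append_cong:
  assumes "ag_eq n p u u'" "ag_word m n v"
  shows "ag_eq m p (u @ v) (u' @ v)"
  using ag_eq.comp[OF assms(1) ag_eq.refl[OF assms(2)]] .

lemma ag_eq_Cons_cong:
  assumes "ag_eq m n v v'" "ag_word n p [l]"
  shows "ag_eq m p (l # v) (l # v')"
  using ag_eq.comp[OF ag_eq.refl[OF assms(2)] assms(1)] by simp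

text \<open>Insertion sort by AG1, read as moving \<open>Alpha i\<close> to the right past
  \<open>Alpha x\<close> with \<open>i \<le> x\<close>, which raises \<open>x\<close> by one. The
  bound \<open>B\<close> records that entries grow by at most one, so the raised head
  \<open>Suc x\<close> stays above the sorted rest.\<close>

lemma ag_eq_Alpha_insert:
  assumes "ag_word m n (map Alpha (i # xs))" "sorted_wrt (>) xs" "i \<le> B" "\<forall>x\<in>set xs. x < B"
  shows "\<exists>ys. sorted_wrt (>) ys \<and> (\<forall>y\<in>set ys. y \<le> B) \<and>
    ag_eq m n (map Alpha (i # xs)) (map Alpha ys)"
  using assms
proof (induction xs arbitrary: n B)
  case Nil
  then show ?case by (intro exI[of _ "[i]"]) (auto intro: ag_eq.refl)
next
  case (Cons x xs)
  show ?case
  proof (cases "x < i")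
    case True
    then show ?thesis using Cons.prems
      by (intro exI[of _ "i # x # xs"]) (force intro: ag_eq.refl)
  next
    case False
    obtain k where k: "n = Suc (Suc k)" "1 \<le> i" "i \<le> n" "1 \<le> x" "x \<le> Suc k"
      "ag_word m k (map Alpha xs)"
      using Cons.prems by auto
    have "ag_eq k n [Alpha i, Alpha x] [Alpha (Suc x), Alpha i]"
      using ag_rel.AG1[of i "Suc x" k] False k by (auto intro!: ag_eq.rel)
    from ag_eq_append_cong[OF this k(6)]
    have 1: "ag_eq m n (map Alpha (i # x # xs)) (Alpha (Suc x) # map Alpha (i # xs))" by simp
    have "ag_word m (Suc k) (map Alpha (i # xs))" using k False by auto
    from Cons.IH[OF this, of x] Cons.prems False obtain ys where
      ys: "sorted_wrt (>) ys" "\<forall>y\<in>set ys. y \<le> x"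
      "ag_eq m (Suc k) (map Alpha (i # xs)) (map Alpha ys)" by auto
    have "ag_eq m n (Alpha (Suc x) # map Alpha (i # xs)) (map Alpha (Suc x # ys))"
      using ag_eq_Cons_cong[OF ys(3), of n "Alpha (Suc x)"] k by simp
    from ag_eq.trans[OF 1 this] show ?thesis
      using ys Cons.prems by (intro exI[of _ "Suc x # ys"]) (auto simp: le_imp_less_Suc)
  qed
qed

lemma ag_eq_Alpha_sort:
  assumes "ag_word m n (map Alpha xs)"
  shows "\<exists>ys. sorted_wrt (>) ys \<and> ag_eq m n (map Alpha xs) (map Alpha ys)"
  using assms
proof (induction xs arbitrary: n)
  case Nil
  then show ?case by (intro exI[of _ "[]"]) (auto intro: ag_eq.refl)
next
  case (Cons x xs)
  then obtain k where k: "n = Suc k" "1 \<le> x" "x \<le> n" "ag_word m k (map Alpha xs)" by auto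
  with Cons.IH obtain ys where ys: "sorted_wrt (>) ys" "ag_eq m k (map Alpha xs) (map Alpha ys)"
    by blast
  from ag_eq_Cons_cong[OF ys(2), of n "Alpha x"] k
  have 1: "ag_eq m n (map Alpha (x # xs)) (map Alpha (x # ys))" by simp
  \<comment> \<open>A crude bound: insertion only needs some number above all entries.\<close>
  have "\<forall>y\<in>set ys. y < x + sum_list ys + 1"
    using member_le_sum_list[of _ ys] by fastforce
  then obtain zs where "sorted_wrt (>) zs" "ag_eq m n (map Alpha (x # ys)) (map Alpha zs)"
    using ag_eq_Alpha_insert[of m n x ys "x + sum_list ys + 1"] ag_eq_sound[OF 1] ys(1) by auto
  then show ?case using ag_eq.trans[OF 1] by blast
qed

lemma word_adj_map:
  "word_adj (map Alpha xs) = map AlphaStar (rev xs)"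
  "word_adj (map AlphaStar xs) = map Alpha (rev xs)"
  by (simp_all add: word_adj_def rev_map)

text \<open>The adjoint of the previous sorting; reversing a word turns decreasing lists into
  increasing ones.\<close>

lemma ag_eq_AlphaStar_sort:
  assumes "ag_word m n (map AlphaStar xs)"
  shows "\<exists>ys. sorted_wrt (<) ys \<and> ag_eq m n (map AlphaStar xs) (map AlphaStar ys)"
proof -
  from ag_word_word_adj[OF assms] ag_eq_Alpha_sort obtain ys where
    "sorted_wrt (>) ys" "ag_eq n m (map Alpha (rev xs)) (map Alpha ys)"
    by (metis word_adj_map(2))
  then show ?thesis
    using ag_eq.adj[of n m "map Alpha (rev xs)" "map Alpha ys"]
    by (intro exI[of _ "rev ys"]) (auto simp: word_adj_map sorted_wrt_rev)
qed

text \<open>AG2 pushes the starred letter rightwards past one \<open>Alpha\<close> at a time,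
  shifting one index or cancelling both letters. The new lists are left unspecified because sorting
  comes afterwards.\<close>

lemma ag_eq_AlphaStar_commute:
  assumes "ag_word m n (AlphaStar i # map Alpha xs @ map AlphaStar js)"
  shows "\<exists>ys ks. ag_eq m n (AlphaStar i # map Alpha xs @ map AlphaStar js)
    (map Alpha ys @ map AlphaStar ks)"
  using assms
proof (induction xs arbitrary: n i)
  case Nil
  then show ?case
    by (intro exI[of _ "[]"] exI[of _ "i # js"]) (auto intro: ag_eq.refl)
next
  case (Cons x xs)
  let ?r = "map Alpha xs @ map AlphaStar js"
  have n: "1 \<le> i" "i \<le> Suc n" "1 \<le> x" "x \<le> Suc n" "ag_word m n ?r" using Cons.prems by auto
  \<comment> \<open>The common part of the cases with unequal indices: one exchange, then the
    induction hypothesis for the starred letter with its new index.\<close>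
  have move: ?case
    if "ag_eq n n [AlphaStar i, Alpha x] [Alpha x', AlphaStar i']"
      "1 \<le> x'" "x' \<le> n" "1 \<le> i'" "i' \<le> n" for x' i'
  proof -
    obtain k where k: "n = Suc k" using \<open>1 \<le> x'\<close> \<open>x' \<le> n\<close> by (cases n) auto
    have 1: "ag_eq m n (AlphaStar i # Alpha x # ?r) (Alpha x' # AlphaStar i' # ?r)"
      using ag_eq_append_cong[OF that(1) n(5)] by simp
    have "ag_word m k (AlphaStar i' # ?r)" using n(5) k that by simp
    from Cons.IH[OF this] obtain ys ks where
      "ag_eq m k (AlphaStar i' # ?r) (map Alpha ys @ map AlphaStar ks)" by blast
    from ag_eq_Cons_cong[OF this, of n "Alpha x'"] k that
    have "ag_eq m n (Alpha x' # AlphaStar i' # ?r) (map Alpha (x' # ys) @ map AlphaStar ks)"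
      by simp
    from ag_eq.trans[OF 1 this] show ?thesis by (metis append_Cons list.simps(9))
  qed
  consider "i < x" | "i = x" | "x < i" by linarith
  then show ?case
  proof cases
    case 1
    then show ?thesis
      using ag_rel.AG2_less[of i x n] n by (intro move[of "x - 1" i]) (auto intro: ag_eq.rel)
  next
    case 2
    have "ag_eq n n [AlphaStar i, Alpha x] []"
      using ag_rel.AG2_eq[of i n] n 2 by (auto intro: ag_eq.rel)
    from ag_eq_append_cong[OF this n(5)] show ?thesis by auto
  next
    case 3
    then show ?thesis
      using ag_rel.AG2_greater[of x i n] n by (intro move[of x "i - 1"]) (auto intro: ag_eq.rel)
  qed
qed

lemma ag_eq_separate:
  assumes "rect w" "ag_word m n w"
  shows "\<exists>xs js. ag_eq m n w (map Alpha xs @ map AlphaStar js)"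
  using assms
proof (induction w arbitrary: n)
  case Nil
  then show ?case by (intro exI[of _ "[]"]) (auto intro: ag_eq.refl)
next
  case (Cons l w)
  then obtain k where k: "ag_word m k w" "ag_word k n [l]" "rect w" "rect [l]"
    using Cons.prems by (auto simp: rect_Cons ag_word_Cons_iff[of m n l w] simp del: ag_word_simps)
  then obtain xs js where w: "ag_eq m k w (map Alpha xs @ map AlphaStar js)"
    using Cons.IH by blast
  have 1: "ag_eq m n (l # w) (l # map Alpha xs @ map AlphaStar js)"
    by (rule ag_eq_Cons_cong[OF w k(2)])
  show ?case
  proof (cases l)
    case (Alpha i)
    with 1 show ?thesis by (intro exI[of _ "i # xs"] exI[of _ js]) auto
  next
    case (AlphaStar i)
    with ag_eq_AlphaStar_commute ag_eq_sound[OF 1] ag_eq.trans[OF 1] show ?thesis by blast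
  qed (use k in auto)
qed

definition rect_form :: "nat list \<Rightarrow> nat list \<Rightarrow> letter list"
  where "rect_form is js = map Alpha (rev is) @ map AlphaStar js"

lemma rect_rect_form [simp]: "rect (rect_form is js)"
  by (simp add: rect_form_def)

lemma ag_eq_rect_form:
  assumes "rect w" "ag_word m n w"
  obtains "is" js where "sorted_wrt (<) is" "sorted_wrt (<) js" "ag_eq m n w (rect_form is js)"
proof -
  obtain xs js where 1: "ag_eq m n w (map Alpha xs @ map AlphaStar js)"
    using ag_eq_separate[OF assms] by blast
  then obtain k where k: "ag_word m k (map AlphaStar js)" "ag_word k n (map Alpha xs)"
    using ag_eq_sound[OF 1] by (auto simp: ag_word_append)
  obtain ys ks where "sorted_wrt (>) ys" "ag_eq k n (map Alpha xs) (map Alpha ys)"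
    "sorted_wrt (<) ks" "ag_eq m k (map AlphaStar js) (map AlphaStar ks)"
    using ag_eq_AlphaStar_sort[OF k(1)] ag_eq_Alpha_sort[OF k(2)] by blast
  then show thesis
    using that[of "rev ys" ks] ag_eq.trans[OF 1 ag_eq.comp]
    by (auto simp: rect_form_def sorted_wrt_rev)
qed

text \<open>The last letter acts first and carries the largest index. Deleting that point does not
  renumber the smaller ones, so the indices are exactly the deleted points in the original
  numbering; hence the induction from the end of the list.\<close>

lemma AlphaStar_Domain:
  assumes "sorted_wrt (<) js" "ag_word m n (map AlphaStar js)"
  shows "set js \<subseteq> {1..m} \<and> Domain (word_rel m (map AlphaStar js)) = {1..m} - set js \<and>
    Range (word_rel m (map AlphaStar js)) = {1..n}"
  using assms
proof (induction js arbitrary: m rule: rev_induct)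
  case Nil
  then show ?case by auto
next
  case (snoc j js)
  obtain k where k: "m = Suc k" "ag_word k n (map AlphaStar js)" "1 \<le> j" "j \<le> m"
    using snoc.prems(2) by (auto simp: ag_word_append)
  let ?R = "word_rel k (map AlphaStar js)"
  have js: "\<forall>i\<in>set js. i < j" "sorted_wrt (<) js"
    using snoc.prems(1) by (auto simp: sorted_wrt_append)
  with snoc.IH k(2) have IH: "set js \<subseteq> {1..k}" "Domain ?R = {1..k} - set js" "Range ?R = {1..n}"
    by auto
  have eq: "word_rel m (map AlphaStar (js @ [j])) = letter_rel m (AlphaStar j) O ?R"
    using k(1) by (simp add: word_rel_append word_rel_single del: word_rel.simps)
  have "a \<in> Domain (letter_rel m (AlphaStar j) O ?R) \<longleftrightarrow> a \<in> {1..m} - set (js @ [j])" for a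
  proof -
    have "a \<in> Domain (letter_rel m (AlphaStar j) O ?R) \<longleftrightarrow>
        (\<exists>b. a = skip j b \<and> b \<in> {1..k} \<and> b \<in> Domain ?R)"
      using k(1) by auto
    also have "\<dots> \<longleftrightarrow> (\<exists>b. a = skip j b \<and> b \<in> {1..k} \<and> b \<notin> set js)"
      using IH(2) by auto
    also have "\<dots> \<longleftrightarrow> a \<in> {1..m} - set (js @ [j])"
    proof
      assume "\<exists>b. a = skip j b \<and> b \<in> {1..k} \<and> b \<notin> set js"
      then show "a \<in> {1..m} - set (js @ [j])"
        using js(1) k by (auto simp: skip_def dest: bspec split: if_splits)
    next
      assume "a \<in> {1..m} - set (js @ [j])"
      then show "\<exists>b. a = skip j b \<and> b \<in> {1..k} \<and> b \<notin> set js"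
        using js(1) k by (intro exI[of _ "if a < j then a else a - 1"])
          (fastforce simp: skip_def split: if_splits)
    qed
    finally show ?thesis .
  qed
  then have "Domain (letter_rel m (AlphaStar j) O ?R) = {1..m} - set (js @ [j])" by blast
  moreover have "Range (letter_rel m (AlphaStar j) O ?R) = {1..n}"
  proof -
    have "Domain ?R \<subseteq> Range (letter_rel m (AlphaStar j))"
      using IH(2) k(1) by (auto simp: Range_iff)
    then show ?thesis using IH(3) by blast
  qed
  moreover have "set (js @ [j]) \<subseteq> {1..m}" using IH(1) k by auto
  ultimately show ?case unfolding eq by blast
qed

lemma rect_form_Domain_Range:
  assumes "sorted_wrt (<) is" "sorted_wrt (<) js" "ag_word m n (rect_form is js)"
  shows "set js = {1..m} - Domain (word_rel m (rect_form is js))"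
    "set is = {1..n} - Range (word_rel m (rect_form is js))"
proof -
  obtain k where k: "ag_word m k (map AlphaStar js)" "ag_word k n (map Alpha (rev is))"
    using assms(3) by (auto simp: rect_form_def ag_word_append)
  let ?A = "word_rel m (map AlphaStar js)" and ?B = "word_rel n (map AlphaStar is)"
  have adj: "word_adj (map Alpha (rev is)) = map AlphaStar is" by (simp add: word_adj_map)
  have "ag_word n k (map AlphaStar is)" "word_rel k (map Alpha (rev is)) = ?B\<inverse>"
    using ag_word_word_adj[OF k(2)] word_rel_word_adj[OF k(2)] adj by auto
  then have eq: "word_rel m (rect_form is js) = ?A O ?B\<inverse>"
    using k by (simp add: rect_form_def word_rel_append ag_word_tgt)
  note A = AlphaStar_Domain[OF assms(2) k(1)]
    and B = AlphaStar_Domain[OF assms(1) \<open>ag_word n k (map AlphaStar is)\<close>]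
  \<comment> \<open>Both halves have full range on the middle object, so composing loses no
    points.\<close>
  have "Domain (?A O ?B\<inverse>) = Domain ?A" "Range (?A O ?B\<inverse>) = Domain ?B"
    using A B by blast+
  with A B eq show "set js = {1..m} - Domain (word_rel m (rect_form is js))"
    "set is = {1..n} - Range (word_rel m (rect_form is js))"
    by auto
qed

text \<open>Completeness: the common action fixes the missing points at both ends, hence both sorted
  index lists, so the two words share one standard form.\<close>

lemma rect_ag_eqI:
  assumes u: "rect u" "ag_word m n u" and v: "rect v" "ag_word m n v"
    and eq: "word_rel m u = word_rel m v"
  shows "ag_eq m n u v"
proof -
  obtain "is" js where 1: "sorted_wrt (<) is" "sorted_wrt (<) js" "ag_eq m n u (rect_form is js)"
    using ag_eq_rect_form[OF u] .
  obtain is' js' where 2: "sorted_wrt (<) is'" "sorted_wrt (<) js'" "ag_eq m n v (rect_form is' js')"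
    using ag_eq_rect_form[OF v] .
  note s1 = ag_eq_sound[OF 1(3)] and s2 = ag_eq_sound[OF 2(3)]
  have "set js = set js'" "set is = set is'"
    using rect_form_Domain_Range[of "is" js m n] rect_form_Domain_Range[of is' js' m n] 1 2 s1 s2 eq
    by auto
  then have "is = is'" "js = js'"
    using 1 2 by (auto intro: strict_sorted_equal)
  then show ?thesis using 1(3) 2(3) by (metis ag_eq.sym ag_eq.trans)
qed

section \<open>The classes of the rectangular GICAR category\<close>

lemma equiv_ag_cong: "equiv {w. ag_word m n w} (ag_cong m n)"
  by (rule equivI)
    (auto simp: refl_on_def sym_def trans_def ag_cong_def dest: ag_eq_sound
      intro: ag_eq.refl ag_eq.sym ag_eq.trans)

lemma ag_cong_Image_eq_iff:
  "\<lbrakk>ag_word m n u; ag_word m n v\<rbrakk> \<Longrightarrow> ag_cong m n `` {u} = ag_cong m n `` {v} \<longleftrightarrow> ag_eq m n u v"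
  using eq_equiv_class_iff[OF equiv_ag_cong, of u m n v] by (simp add: ag_cong_def)

text \<open>Since \<open>class_comp\<close> saturates the set of concatenations, any pair of
  representatives computes it.\<close>

lemma class_comp_Image:
  assumes "ag_word m n v" "ag_word n p u"
  shows "class_comp m p (ag_cong n p `` {u}) (ag_cong m n `` {v}) = ag_cong m p `` {u @ v}"
proof (rule set_eqI)
  fix x
  have "x \<in> class_comp m p (ag_cong n p `` {u}) (ag_cong m n `` {v}) \<longleftrightarrow>
      (\<exists>u' v'. ag_eq n p u u' \<and> ag_eq m n v v' \<and> ag_eq m p (u' @ v') x)"
    by (auto simp: class_comp_def ag_cong_def)
  also have "\<dots> \<longleftrightarrow> ag_eq m p (u @ v) x"
    using assms by (blast intro: ag_eq.refl ag_eq.trans ag_eq.comp)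
  finally show "x \<in> class_comp m p (ag_cong n p `` {u}) (ag_cong m n `` {v}) \<longleftrightarrow>
      x \<in> ag_cong m p `` {u @ v}"
    by (simp add: ag_cong_def)
qed

lemma class_adj_Image:
  assumes "ag_word m n w"
  shows "class_adj m n (ag_cong m n `` {w}) = ag_cong n m `` {word_adj w}"
  unfolding class_adj_def
  using ag_eq.refl[OF assms] by (auto simp: ag_cong_def intro: ag_eq.trans ag_eq.adj)

definition rect_word :: "nat \<Rightarrow> nat \<Rightarrow> (nat \<times> nat) set \<Rightarrow> letter list"
  where "rect_word m n R = (SOME w. rect w \<and> ag_word m n w \<and> word_rel m w = R)"

definition rect_class :: "nat \<Rightarrow> nat \<Rightarrow> (nat \<times> nat) set \<Rightarrow> letter list set"
  where "rect_class m n R = ag_cong m n `` {rect_word m n R}"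

lemma rect_word:
  assumes "pinj m n R"
  shows "rect (rect_word m n R)" "ag_word m n (rect_word m n R)" "word_rel m (rect_word m n R) = R"
proof -
  have "\<exists>w. rect w \<and> ag_word m n w \<and> word_rel m w = R" using ex_rect_word[OF assms] by metis
  from someI_ex[OF this] show "rect (rect_word m n R)" "ag_word m n (rect_word m n R)"
    "word_rel m (rect_word m n R) = R"
    unfolding rect_word_def by auto
qed

text \<open>Frees \<open>rect_class\<close> from the chosen representative: any rectangular word
  with the right action may replace it.\<close>

lemma rect_class_word_rel:
  assumes "rect w" "ag_word m n w"
  shows "rect_class m n (word_rel m w) = ag_cong m n `` {w}"
  using rect_word[OF pinj_word_rel[OF assms]] assms
  by (simp add: rect_class_def ag_cong_Image_eq_iff rect_ag_eqI)

text \<open>Injectivity is soundness of the action. The image is right because rectangular words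
  have \<tau>-free standard forms, and such forms are themselves rectangular.\<close>

lemma bij_betw_rect_class: "bij_betw (rect_class m n) {R. pinj m n R} (tau_free_classes m n)"
  unfolding bij_betw_def
proof
  show "inj_on (rect_class m n) {R. pinj m n R}"
  proof (rule inj_onI; clarify)
    fix R S assume "pinj m n R" "pinj m n S" "rect_class m n R = rect_class m n S"
    then show "R = S"
      using rect_word[of m n R] rect_word[of m n S] ag_eq_sound
      by (metis ag_cong_Image_eq_iff rect_class_def)
  qed
  show "rect_class m n ` {R. pinj m n R} = tau_free_classes m n"
  proof (intro equalityI subsetI)
    fix X assume "X \<in> rect_class m n ` {R. pinj m n R}"
    then obtain R where R: "pinj m n R" "X = rect_class m n R" by auto
    let ?w = "rect_word m n R"
    obtain "is" js where f: "sorted_wrt (<) is" "sorted_wrt (<) js" "ag_eq m n ?w (rect_form is js)"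
      using ag_eq_rect_form[OF rect_word(1,2)[OF R(1)]] .
    have w: "ag_word m n (rect_form is js)" using ag_eq_sound f(3) by blast
    \<comment> \<open>For \<open>r = 0\<close> the numerical condition in
      \<open>standard_form\<close>, with its truncated subtraction, amounts to this bound.\<close>
    have "length js \<le> m"
      using rect_form_Domain_Range(1)[OF f(1,2) w] f(2)
      by (metis Diff_subset card_atLeastAtMost card_mono diff_Suc_1 distinct_card finite_atLeastAtMost
          strict_sorted_iff)
    then have "standard_form m n (rect_form is js)"
      using f w unfolding standard_form_def rect_form_def
      by (intro conjI exI[of _ "is"] exI[of _ 0] exI[of _ js]) auto
    moreover have "Tau \<notin> set (rect_form is js)"
      using rect_rect_form by (simp add: rect_def)
    moreover have "rect_form is js \<in> X"
      using f(3) by (simp add: R(2) rect_class_def ag_cong_def)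
    moreover have "X \<in> ag_classes m n"
      using rect_word(2)[OF R(1)] by (auto simp: R(2) rect_class_def ag_classes_def intro: quotientI)
    ultimately show "X \<in> tau_free_classes m n" by (auto simp: tau_free_classes_def)
  next
    fix X assume "X \<in> tau_free_classes m n"
    then obtain w where w: "X \<in> ag_classes m n" "w \<in> X" "standard_form m n w" "Tau \<notin> set w"
      by (auto simp: tau_free_classes_def)
    have "ag_word m n w" "rect w"
      using w(3,4) by (auto simp: standard_form_def rect_def)
    moreover have "X = ag_cong m n `` {w}"
      using w(1,2) quotient_eq_iff[OF equiv_ag_cong] unfolding ag_classes_def
      by (metis Image_singleton_iff equiv_class_eq equiv_ag_cong quotientE)
    ultimately show "X \<in> rect_class m n ` {R. pinj m n R}"
      using rect_class_word_rel[of w m n] pinj_word_rel[of w m n] by blast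
  qed
qed

section \<open>The equivalence\<close>

text \<open>The arguments are swapped in \<open>R O S\<close> because \<open>O\<close> applies its
  left factor first, whereas composition in \<open>star_cat\<close> lists the later morphism
  first.\<close>

lemma basis_star_category_pinj:
  "basis_star_category (\<lambda>m n. {R. pinj m n R}) (\<lambda>n. Id_on {1..n}) (\<lambda>m n p S R. R O S)
    (\<lambda>m n R. R\<inverse>)"
proof
  show "Id_on {1..m} O R = R" "R O Id_on {1..n} = R" if "R \<in> {R. pinj m n R}" for R m n
    using that unfolding pinj_def by fast+
  show "Id_on {1..n} \<in> {R. pinj n n R}" for n
    using pinj_Id by blast
qed (auto simp: pinj_relcomp pinj_converse converse_relcomp O_assoc)

lemma basis_star_iso_diagram:
  "basis_star_iso (\<lambda>m n. {R. pinj m n R}) (\<lambda>n. Id_on {1..n}) (\<lambda>m n p S R. R O S) (\<lambda>m n R. R\<inverse>)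
    (\<lambda>m n. {D. rook_diagram m n D}) id_diagram (\<lambda>m n p. stack) (\<lambda>m n. reflect) diagram"
  by (intro basis_star_iso.intro basis_star_category_pinj basis_star_iso_axioms.intro
      bij_betw_diagram diagram_Id diagram_converse) (simp add: diagram_relcomp)

lemma basis_star_iso_rect_class:
  "basis_star_iso (\<lambda>m n. {R. pinj m n R}) (\<lambda>n. Id_on {1..n}) (\<lambda>m n p S R. R O S) (\<lambda>m n R. R\<inverse>)
    tau_free_classes (\<lambda>n. ag_cong n n `` {[]}) (\<lambda>m n p. class_comp m p) class_adj rect_class"
proof (intro basis_star_iso.intro basis_star_category_pinj basis_star_iso_axioms.intro
    bij_betw_rect_class)
  show "rect_class n n (Id_on {1..n}) = ag_cong n n `` {[]}" for n
    using rect_class_word_rel[of "[]" n n] by simp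
  fix m n p R S assume R: "R \<in> {R. pinj m n R}"
  then obtain v where v: "rect v" "ag_word m n v" "word_rel m v = R"
    using ex_rect_word by blast
  show "rect_class n m (R\<inverse>) = class_adj m n (rect_class m n R)"
    using rect_class_word_rel[of "word_adj v" n m] rect_class_word_rel[of v m n] v
    by (simp add: ag_word_word_adj word_rel_word_adj class_adj_Image)
  assume "S \<in> {R. pinj n p R}"
  then obtain u where u: "rect u" "ag_word n p u" "word_rel n u = S"
    using ex_rect_word by blast
  show "rect_class m p (R O S) = class_comp m p (rect_class n p S) (rect_class m n R)"
    using rect_class_word_rel[of "u @ v" m p] rect_class_word_rel[of u n p]
      rect_class_word_rel[of v m n] u v
    by (simp add: word_rel_append ag_word_tgt ag_word_appendI class_comp_Image)
qed

theorem theorem3p24: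
  shows "star_equivalent RP RG"
proof -
  \<comment> \<open>Inverting the first isomorphism puts rook diagrams at the source; linearising
    its composite with the second gives exactly the records \<open>RP\<close> and
    \<open>RG\<close>.\<close>
  interpret basis_star_iso "\<lambda>m n. {D. rook_diagram m n D}" id_diagram "\<lambda>m n p. stack"
    "\<lambda>m n. reflect" tau_free_classes "\<lambda>n. ag_cong n n `` {[]}" "\<lambda>m n p. class_comp m p"
    class_adj "\<lambda>m n. rect_class m n \<circ> inv_into {R. pinj m n R} (diagram m n)"
    using basis_star_iso_comp[OF basis_star_iso.inverse_iso[OF basis_star_iso_diagram]
        basis_star_iso_rect_class] .
  show ?thesis
    using star_equivalent_lin_cat by (simp add: lin_cat_def RP_def RG_def AG_def)
qed

end
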